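(* Let $p>1$, $n\geq 2$, $\alpha\geq 0$, and let $f_1,f_2$, $g_1,g_2,g_3$, $h_1,h_2,h_3$ be functions on $[0,\infty)$ such that: (B1) each $f_i,g_j,h_j$ is continuous, non-decreasing in $[0,\infty)$ and positive in $(0,\infty)$; (B2) each $g_j,h_j$ is differentiable in $[0,\infty)$, and $g_1,g_2,h_1,h_2$ are increasing in $(0,\infty)$; (B3) for each $j=1,2,3$, the quotient $Q_j(s,t)=g_j(st)/h_j(t)$ is non-increasing in $t$ for all $s\geq 1$, $t>0$; (B4) there exist constants $k_j\geq 0$ such that $\lim_{t\to\infty}Q_j(s,t)=s^{k_j}$ for each $s\geq 1$ and each $j=1,2,3$. Suppose that $(u,v)$ and $(u_0,v_0)$ are non-constant radial solutions of $$\Delta_p u = f_1(|x|)\, g_1(v)\, |\nabla u|^{\alpha}, \qquad \Delta_p v = f_2(|x|)\, g_2(v)\, g_3(|\nabla u|) \qquad \text{in } \mathbb R^n$$ and $$\Delta_p u_0 = f_1(|x|)\, h_1(v_0)\, |\nabla u_0|^{\alpha}, \qquad \Delta_p v_0 = f_2(|x|)\, h_2(v_0)\, h_3(|\nabla u_0|) \qquad \text{in } \mathbb R^n,$$ respectively, which are positive for all $r>0$. If $u(0),v(0)>0$ and $(u_0,v_0)$ satisfies $$u_0(0)=v_0(0)=0,\qquad \lim_{r\to0^+}\frac{u_0(r)}{u_0'(r)}<\infty,\qquad \lim_{r\to0^+}\frac{v_0(r)}{v_0'(r)}<\infty ,$$ then $$\lim_{r\to\infty}\frac{u(r)}{u_0(r)}=\lim_{r\to\infty}\frac{v(r)}{v_0(r)}=\lim_{r\to\infty}\frac{u'(r)}{u_0'(r)}=\lim_{r\to\infty}\frac{v'(r)}{v_0'(r)}=1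 .$$
   Context: $\Delta_p u=\operatorname{div}(|\nabla u|^{p-2}\nabla u)$ is the $p$-Laplace operator. "Increasing" is meant strictly. Radial functions are written as functions of $r=|x|$, and $'$ denotes $d/dr$. A radial solution $(u,v)$ of a system $\Delta_p u = F_1$, $\Delta_p v=F_2$ in $\mathbb R^n$, where $F_1=f_1(|x|)\,G_1(v)\,|\nabla u|^{\alpha}$ and $F_2=f_2(|x|)\,G_2(v)\,G_3(|\nabla u|)$ with either $G_j=g_j$ for $j=1,2,3$ or $G_j=h_j$ for $j=1,2,3$, satisfies the corresponding radial equations $$[r^{n-1}u'(r)|u'(r)|^{p-2}]'=r^{n-1}F_1,\qquad [r^{n-1}v'(r)|v'(r)|^{p-2}]'=r^{n-1}F_2,$$ for all $r>0$, where $F_1,F_2$ are the right-hand sides evaluated with $|x|=r$, $|\nabla u|=|u'(r)|$, together with $u'(0)=v'(0)=0$. "Positive for all $r>0$" means that both components are positive for all $r>0$. *)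

theory Defs
  imports "HOL-Analysis.Analysis"
begin

definition grad :: "('a::euclidean_space \<Rightarrow> real) \<Rightarrow> 'a \<Rightarrow> 'a" where
  "grad U x = (THE D. GDERIV U x :> D)"

definition divergence :: "('a::euclidean_space \<Rightarrow> 'a) \<Rightarrow> 'a \<Rightarrow> real" where
  "divergence V x = (\<Sum>b\<in>Basis. frechet_derivative V (at x) b \<bullet> b)"

text \<open>Where the gradient vanishes the flux is \<open>0\<close>, also for \<open>1 < p < 2\<close>.\<close>

definition p_flux :: "real \<Rightarrow> ('a::euclidean_space \<Rightarrow> real) \<Rightarrow> 'a \<Rightarrow> 'a" where
  "p_flux p U x = norm (grad U x) powr (p - 2) *\<^sub>R grad U x"

definition p_laplacian :: "real \<Rightarrow> ('a::euclidean_space \<Rightarrow> real) \<Rightarrow> 'a \<Rightarrow> real" where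
  "p_laplacian p U = divergence (p_flux p U)"

text \<open>
  Pointwise solutions of \<open>\<Delta>\<^sub>p U = F\<close> on the whole space. Differentiability of the flux makes
  it continuous, so for \<open>p > 1\<close> every such \<open>U\<close> is of class \<open>C\<^sup>1\<close>.
\<close>

definition solves_p_laplace ::
    "real \<Rightarrow> ('a::euclidean_space \<Rightarrow> real) \<Rightarrow> ('a \<Rightarrow> real) \<Rightarrow> bool" where
  "solves_p_laplace p U F \<longleftrightarrow>
     (\<forall>x. U differentiable (at x) \<and> p_flux p U differentiable (at x) \<and> p_laplacian p U x = F x)"

text \<open>
  \<open>t\<^sup>a\<close> for \<open>t, a \<ge> 0\<close>, with \<open>0\<^sup>0 = 1\<close>; the library has \<open>0 powr 0 = 0\<close>, which would make
  \<open>|\<nabla>u|\<^sup>0\<close> vanish at critical points of \<open>u\<close>.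
\<close>

definition rpow :: "real \<Rightarrow> real \<Rightarrow> real" where
  "rpow t a = (if a = 0 then 1 else t powr a)"

definition solves_system ::
    "real \<Rightarrow> real \<Rightarrow> (nat \<Rightarrow> real \<Rightarrow> real) \<Rightarrow> (nat \<Rightarrow> real \<Rightarrow> real) \<Rightarrow>
     ('a::euclidean_space \<Rightarrow> real) \<Rightarrow> ('a \<Rightarrow> real) \<Rightarrow> bool" where
  "solves_system p \<alpha> f G U V \<longleftrightarrow>
     solves_p_laplace p U (\<lambda>x. f 1 (norm x) * G 1 (V x) * rpow (norm (grad U x)) \<alpha>) \<and>
     solves_p_laplace p V (\<lambda>x. f 2 (norm x) * G 2 (V x) * G 3 (norm (grad U x)))"

text \<open>
  For radial functions, \<open>solves_system\<close> yields the usual radial equations for \<open>r > 0\<close> and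
  \<open>u'(0) = v'(0) = 0\<close>; see \<open>solves_system_radial\<close>, and \<open>solves_p_laplace_of_radial\<close> for the
  converse.
\<close>

lemma grad_eqI:
  assumes "GDERIV U x :> D" shows "grad U x = D"
  unfolding grad_def
proof (rule the_equality)
  show "GDERIV U x :> D" by (fact assms)
next
  fix E assume "GDERIV U x :> E"
  with assms have "(\<lambda>h. h \<bullet> E) = (\<lambda>h. h \<bullet> D)"
    unfolding gderiv_def by (rule has_derivative_unique[rotated])
  then have "(E - D) \<bullet> E = (E - D) \<bullet> D" by (rule fun_cong)
  then have "(E - D) \<bullet> (E - D) = 0" by (simp add: inner_diff_right)
  then show "E = D" by simp
qed

lemma grad_radial:
  fixes x :: "'a::euclidean_space"
  assumes "u differentiable (at (norm x))" "x \<noteq> 0"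
  shows "grad (\<lambda>x. u (norm x)) x = deriv u (norm x) *\<^sub>R sgn x"
proof (rule grad_eqI, rule GDERIV_DERIV_compose[where g = u])
  show "GDERIV norm x :> sgn x" by (rule GDERIV_norm[OF assms(2)])
  show "DERIV u (norm x) :> deriv u (norm x)"
    using assms(1) by (simp add: DERIV_deriv_iff_real_differentiable)
qed

lemma p_flux_radial:
  fixes x :: "'a::euclidean_space"
  assumes "u differentiable (at (norm x))" "x \<noteq> 0"
  shows "p_flux p (\<lambda>x. u (norm x)) x =
    (deriv u (norm x) * \<bar>deriv u (norm x)\<bar> powr (p - 2)) *\<^sub>R sgn x"
  using assms by (simp add: p_flux_def grad_radial norm_sgn mult.commute)

lemma p_laplacian_radial:
  fixes x :: "'a::euclidean_space" and u \<phi> :: "real \<Rightarrow> real" and p \<phi>' :: real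
  defines "\<phi> \<equiv> \<lambda>r. deriv u r * \<bar>deriv u r\<bar> powr (p - 2)"
  assumes u: "\<And>r. r > 0 \<Longrightarrow> u differentiable (at r)" and x: "x \<noteq> 0"
    and \<phi>: "(\<phi> has_real_derivative \<phi>') (at (norm x))"
  shows "p_flux p (\<lambda>x. u (norm x)) differentiable (at x)"
    and "p_laplacian p (\<lambda>x::'a. u (norm x)) x = \<phi>' + (DIM('a) - 1) * \<phi> (norm x) / norm x"
proof -
  define r where "r = norm x"
  have r: "r > 0" using x by (simp add: r_def)
  define q' where "q' = (\<phi>' * r - \<phi> r) / r\<^sup>2"
  define D where "D = (\<lambda>h. (\<phi> r / r) *\<^sub>R h + ((sgn x \<bullet> h) * q') *\<^sub>R x)"
  have q: "((\<lambda>r. \<phi> r / r) has_real_derivative q') (at (norm x))"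
    using \<phi> r unfolding r_def q'_def by (auto intro!: derivative_eq_intros simp: power2_eq_square)
  have "GDERIV (\<lambda>x. \<phi> (norm x) / norm x) x :> q' *\<^sub>R sgn x"
    by (rule GDERIV_DERIV_compose[OF GDERIV_norm[OF x] q])
  then have *: "((\<lambda>x. \<phi> (norm x) / norm x) has_derivative (\<lambda>h. h \<bullet> (q' *\<^sub>R sgn x))) (at x)"
    unfolding gderiv_def .
  have "((\<lambda>x. (\<phi> (norm x) / norm x) *\<^sub>R x) has_derivative D) (at x)"
    by (rule has_derivative_eq_rhs[OF has_derivative_scaleR[OF * has_derivative_ident]])
      (auto simp: D_def r_def inner_commute fun_eq_iff mult.commute)
  moreover have "\<forall>\<^sub>F y in nhds x. (\<phi> (norm y) / norm y) *\<^sub>R y = p_flux p (\<lambda>x. u (norm x)) y"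
  proof (rule eventually_mono)
    show "\<forall>\<^sub>F y in nhds x. y \<noteq> 0" using x by (rule t1_space_nhds)
    show "(\<phi> (norm y) / norm y) *\<^sub>R y = p_flux p (\<lambda>x. u (norm x)) y" if "y \<noteq> 0" for y
      using that by (simp add: p_flux_radial u \<phi>_def sgn_div_norm divide_inverse)
  qed
  then obtain S where "open S" "x \<in> S"
    "\<And>y. y \<in> S \<Longrightarrow> (\<phi> (norm y) / norm y) *\<^sub>R y = p_flux p (\<lambda>x. u (norm x)) y"
    unfolding eventually_nhds by blast
  ultimately have D: "(p_flux p (\<lambda>x. u (norm x)) has_derivative D) (at x)"
    by (rule has_derivative_transform_within_open)
  then show "p_flux p (\<lambda>x. u (norm x)) differentiable (at x)"
    by (auto simp: differentiable_def)
  have "p_laplacian p (\<lambda>x::'a. u (norm x)) x = (\<Sum>b\<in>Basis. D b \<bullet> b)"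
    unfolding p_laplacian_def divergence_def using frechet_derivative_at[OF D] by simp
  also have "\<dots> = (\<Sum>b\<in>(Basis::'a set). \<phi> r / r * (b \<bullet> b)) + q' * (\<Sum>b\<in>Basis. (sgn x \<bullet> b) * (x \<bullet> b))"
    by (simp add: D_def inner_add_left sum.distrib sum_distrib_left mult_ac)
  also have "(\<Sum>b\<in>(Basis::'a set). \<phi> r / r * (b \<bullet> b)) = DIM('a) * \<phi> r / r"
    by simp
  also have "(\<Sum>b\<in>Basis. (sgn x \<bullet> b) * (x \<bullet> b)) = r"
    using x unfolding euclidean_inner[symmetric]
    by (simp add: sgn_div_norm r_def dot_square_norm power2_eq_square)
  also have "DIM('a) * \<phi> r / r + q' * r = \<phi>' + (DIM('a) - 1) * \<phi> r / r"
    using r DIM_positive[where 'a='a] by (simp add: q'_def field_simps power2_eq_square of_nat_diff)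
  finally show "p_laplacian p (\<lambda>x::'a. u (norm x)) x =
      \<phi>' + (DIM('a) - 1) * \<phi> (norm x) / norm x" by (simp add: r_def)
qed

lemma differentiable_radial:
  fixes u :: "real \<Rightarrow> real"
  assumes d: "\<And>x::'a::euclidean_space. (\<lambda>x. u (norm x)) differentiable (at x)"
  shows "(u has_real_derivative 0) (at 0 within {0..})"
    and "r > 0 \<Longrightarrow> u differentiable (at r)"
proof -
  obtain e :: 'a where "e \<in> Basis" using SOME_Basis by blast
  then have e: "norm e = 1" by simp
  have comp: "(\<lambda>t. u (norm (t *\<^sub>R e))) differentiable (at r)" for r
    using differentiable_chain_at[of "\<lambda>t. t *\<^sub>R e" r "\<lambda>x. u (norm x)"] d
    by (simp add: o_def)
  show "u differentiable (at r)" if "r > 0" for r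
  proof -
    have "((\<lambda>t. u (norm (t *\<^sub>R e))) has_derivative (frechet_derivative (\<lambda>t. u (norm (t *\<^sub>R e))) (at r))) (at r)"
      using comp frechet_derivative_works by blast
    then have "(u has_derivative (frechet_derivative (\<lambda>t. u (norm (t *\<^sub>R e))) (at r))) (at r)"
      by (rule has_derivative_transform_within_open[of _ _ _ _ "{0<..}"]) (use that e in auto)
    then show ?thesis by (auto simp: differentiable_def)
  qed
  have "(\<lambda>t. u \<bar>t\<bar>) differentiable (at 0)"
    using comp[of 0] e by simp
  then obtain c where c: "((\<lambda>t. u \<bar>t\<bar>) has_real_derivative c) (at 0)"
    by (auto simp: real_differentiable_def)
  then have "((\<lambda>t. u \<bar>- t\<bar>) has_real_derivative - c) (at 0)"
    using DERIV_mirror[of "\<lambda>t. u \<bar>t\<bar>" c 0] by simp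
  with c have "c = - c" by (auto dest: DERIV_unique)
  then have "c = 0" by simp
  with c have "((\<lambda>t. u \<bar>t\<bar>) has_real_derivative 0) (at 0 within {0..})"
    using has_field_derivative_at_within by blast
  then show "(u has_real_derivative 0) (at 0 within {0..})"
    by (rule has_field_derivative_transform_within[where d = 1]) auto
qed

lemma solves_p_laplace_radial:
  fixes u :: "real \<Rightarrow> real"
  assumes sol: "solves_p_laplace p (\<lambda>x::'a::euclidean_space. u (norm x)) (\<lambda>x. F (norm x))"
    and r: "r > 0"
  shows "((\<lambda>r. r ^ (DIM('a) - 1) * (deriv u r * \<bar>deriv u r\<bar> powr (p - 2)))
    has_real_derivative r ^ (DIM('a) - 1) * F r) (at r)"
proof -
  define \<phi> where "\<phi> = (\<lambda>r. deriv u r * \<bar>deriv u r\<bar> powr (p - 2))"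
  have d: "\<And>x::'a. (\<lambda>x. u (norm x)) differentiable (at x)"
    using sol by (auto simp: solves_p_laplace_def)
  note u = differentiable_radial(2)[OF d]
  obtain e :: 'a where "e \<in> Basis" using SOME_Basis by blast
  then have e: "norm e = 1" by simp
  then have e0: "e \<noteq> 0" by auto
  have "(\<lambda>t. p_flux p (\<lambda>x. u (norm x)) (t *\<^sub>R e)) differentiable (at r)"
    using differentiable_chain_at[of "\<lambda>t. t *\<^sub>R e" r "p_flux p (\<lambda>x. u (norm x))"] sol
    by (simp add: o_def solves_p_laplace_def)
  then have "(\<lambda>t. p_flux p (\<lambda>x. u (norm x)) (t *\<^sub>R e) \<bullet> e) differentiable (at r)"
    by (intro differentiable_inner) auto
  then obtain c where
    "((\<lambda>t. p_flux p (\<lambda>x. u (norm x)) (t *\<^sub>R e) \<bullet> e) has_real_derivative c) (at r)"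
    by (auto simp: real_differentiable_def)
  then have c: "(\<phi> has_real_derivative c) (at r)"
    by (rule has_field_derivative_transform_within_open[of _ _ _ "{0<..}"])
      (use r e e0 in \<open>auto simp: p_flux_radial u \<phi>_def sgn_div_norm dot_square_norm\<close>)
  have "F r = p_laplacian p (\<lambda>x::'a. u (norm x)) (r *\<^sub>R e)"
    using sol r e by (simp add: solves_p_laplace_def)
  also have "\<dots> = c + (DIM('a) - 1) * \<phi> r / r"
    using p_laplacian_radial(2)[of u "r *\<^sub>R e" p c] u c r e e0 by (simp add: \<phi>_def)
  finally have F: "F r = c + (DIM('a) - 1) * \<phi> r / r" .
  have "((\<lambda>r. r ^ (DIM('a) - 1) * \<phi> r) has_real_derivative
      real (DIM('a) - 1) * r ^ (DIM('a) - 1 - 1) * \<phi> r + c * r ^ (DIM('a) - 1)) (at r)"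
    by (rule derivative_eq_intros c refl)+ simp
  also have "real (DIM('a) - 1) * r ^ (DIM('a) - 1 - 1) * \<phi> r + c * r ^ (DIM('a) - 1)
      = r ^ (DIM('a) - 1) * F r"
    using r unfolding F by (cases "DIM('a) - 1") (auto simp: field_simps of_nat_diff)
  finally show ?thesis by (simp add: \<phi>_def)
qed

text \<open>
  Conversely, \<open>C\<^sup>1\<close> solutions of the radial equation solve the equation in the whole space, the
  origin included, whenever the right-hand side is continuous there.
\<close>

lemma solves_p_laplace_of_radial:
  fixes u F :: "real \<Rightarrow> real"
  assumes p: "p > 1"
    and F0: "(F \<longlongrightarrow> F 0) (at_right 0)"
    and u0: "(u has_real_derivative 0) (at 0 within {0..})" "(deriv u \<longlongrightarrow> 0) (at_right 0)"
    and u: "\<And>r. r > 0 \<Longrightarrow> u differentiable (at r)"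
    and ode: "\<And>r. r > 0 \<Longrightarrow>
      ((\<lambda>r. r ^ (DIM('a) - 1) * (deriv u r * \<bar>deriv u r\<bar> powr (p - 2)))
        has_real_derivative r ^ (DIM('a) - 1) * F r) (at r)"
  shows "solves_p_laplace p (\<lambda>x::'a::euclidean_space. u (norm x)) (\<lambda>x. F (norm x))"
proof -
  let ?U = "\<lambda>x::'a. u (norm x)"
  define m where "m = DIM('a) - 1"
  have DIM: "DIM('a) = Suc m" using DIM_positive[where 'a='a] by (simp add: m_def)
  define \<phi> where "\<phi> = (\<lambda>r. deriv u r * \<bar>deriv u r\<bar> powr (p - 2))"
  have ode: "((\<lambda>r. r ^ m * \<phi> r) has_real_derivative r ^ m * F r) (at r)" if "r > 0" for r
    using ode[OF that] by (simp add: \<phi>_def m_def)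
  have \<phi>': "(\<phi> has_real_derivative F r - m * \<phi> r / r) (at r)" if r: "r > 0" for r
  proof -
    have "((\<lambda>r. r ^ m * \<phi> r / r ^ m) has_real_derivative
        ((r ^ m * F r) * r ^ m - (r ^ m * \<phi> r) * (m * r ^ (m - 1))) / (r ^ m * r ^ m)) (at r)"
      by (rule DERIV_divide[OF ode[OF r]]) (use r DERIV_pow[of m r] in auto)
    also have "((r ^ m * F r) * r ^ m - (r ^ m * \<phi> r) * (m * r ^ (m - 1))) / (r ^ m * r ^ m)
        = F r - m * \<phi> r / r"
      using r by (cases m) (auto simp: field_simps)
    finally show ?thesis
      by (rule has_field_derivative_transform_within_open[of _ _ _ "{0<..}"]) (use r in auto)
  qed
  have off0: "p_flux p ?U differentiable (at x)" "p_laplacian p ?U x = F (norm x)"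
    "?U differentiable (at x)" if x: "x \<noteq> 0" for x
  proof -
    have r: "norm x > 0" using x by simp
    note * = p_laplacian_radial[where p = p, OF u x, folded \<phi>_def, OF _ \<phi>'[OF r]]
    show "p_flux p ?U differentiable (at x)" "p_laplacian p ?U x = F (norm x)"
      using *(1) *(2) by (auto simp: DIM \<phi>_def)
    show "?U differentiable (at x)"
      using differentiable_chain_at[OF differentiable_norm_at[OF x] u[OF r]] by (simp add: o_def)
  qed
  have norm0: "filterlim norm (at_right 0) (at (0::'a))"
    unfolding filterlim_at by (auto simp: eventually_at_filter intro!: tendsto_eq_intros)
  have "((\<lambda>r. (u r - u 0) / r) \<longlongrightarrow> 0) (at_right 0)"
    using u0(1) unfolding has_field_derivative_iff
    by (auto intro: tendsto_within_subset)
  from tendsto_norm_zero[OF filterlim_compose[OF this norm0]]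
  have D0: "(?U has_derivative (\<lambda>h. 0)) (at 0)"
    unfolding has_derivative_at by (simp add: divide_inverse norm_mult abs_mult)
  then have grad0: "grad ?U 0 = 0" by (intro grad_eqI) (simp add: gderiv_def)
  then have flux0: "p_flux p ?U 0 = 0" by (simp add: p_flux_def)

  have abs_phi: "\<bar>\<phi> r\<bar> = \<bar>deriv u r\<bar> powr (p - 1)" for r
    by (cases "deriv u r = 0") (auto simp: \<phi>_def abs_mult powr_mult_base)
  have "((\<lambda>r. \<bar>deriv u r\<bar> powr (p - 1)) \<longlongrightarrow> 0) (at_right 0)"
    using p by (intro tendsto_eq_intros tendsto_zero_powrI u0(2) tendsto_const) (auto intro: tendsto_rabs_zero u0(2))
  then have \<phi>0: "(\<phi> \<longlongrightarrow> 0) (at_right 0)"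
    unfolding abs_phi[symmetric] by (rule tendsto_rabs_zero_cancel)
  define c where "c = F 0 / Suc m"
  have "((\<lambda>r. (r ^ m * \<phi> r) / r ^ Suc m) \<longlongrightarrow> c) (at_right 0)"
  proof (rule lhopital_right_0)
    have pos: "\<forall>\<^sub>F r in at_right (0::real). r > 0" by (simp add: eventually_at_right_less)
    have "((\<lambda>r. r ^ m * \<phi> r) \<longlongrightarrow> 0 ^ m * 0) (at_right 0)" by (intro tendsto_intros \<phi>0)
    then show "((\<lambda>r. r ^ m * \<phi> r) \<longlongrightarrow> 0) (at_right 0)" by simp
    have "((\<lambda>r::real. r ^ Suc m) \<longlongrightarrow> 0 ^ Suc m) (at_right 0)" by (intro tendsto_intros)
    then show "((\<lambda>r::real. r ^ Suc m) \<longlongrightarrow> 0) (at_right 0)" by simp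
    show "\<forall>\<^sub>F r in at_right (0::real). r ^ Suc m \<noteq> 0"
      "\<forall>\<^sub>F r in at_right (0::real). Suc m * r ^ m \<noteq> 0"
      "\<forall>\<^sub>F r in at_right 0. ((\<lambda>r. r ^ m * \<phi> r) has_real_derivative r ^ m * F r) (at r)"
      by (rule eventually_mono[OF pos]; simp add: ode)+
    show "\<forall>\<^sub>F r in at_right (0::real). ((\<lambda>r. r ^ Suc m) has_real_derivative Suc m * r ^ m) (at r)"
      by (intro always_eventually allI) (rule DERIV_pow[THEN DERIV_cong], simp)
    have "((\<lambda>r. F r / Suc m) \<longlongrightarrow> c) (at_right 0)"
      unfolding c_def by (intro tendsto_intros F0) simp
    then show "((\<lambda>r::real. (r ^ m * F r) / (Suc m * r ^ m)) \<longlongrightarrow> c) (at_right 0)"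
      by (rule Lim_transform_eventually) (rule eventually_mono[OF pos], simp)
  qed
  then have "((\<lambda>r. \<phi> r / r) \<longlongrightarrow> c) (at_right 0)"
    by (rule Lim_transform_eventually) (auto simp: eventually_at_filter)
  then have "((\<lambda>r. \<bar>\<phi> r / r - c\<bar>) \<longlongrightarrow> 0) (at_right 0)"
    by (simp add: LIM_zero tendsto_rabs_zero)
  from filterlim_compose[OF this norm0]
  have "((\<lambda>x::'a. \<bar>\<phi> (norm x) / norm x - c\<bar>) \<longlongrightarrow> 0) (at 0)" .
  then have "((\<lambda>x::'a. norm (p_flux p ?U x - c *\<^sub>R x) / norm x) \<longlongrightarrow> 0) (at 0)"
  proof (rule Lim_transform_eventually)
    have "norm (p_flux p ?U x - c *\<^sub>R x) / norm x = \<bar>\<phi> (norm x) / norm x - c\<bar>" if "x \<noteq> 0" for x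
    proof -
      have "p_flux p ?U x - c *\<^sub>R x = (\<phi> (norm x) / norm x - c) *\<^sub>R x"
        using that by (simp add: p_flux_radial u \<phi>_def sgn_div_norm divide_inverse scaleR_diff_left)
      then show ?thesis using that by simp
    qed
    then show "\<forall>\<^sub>F x in at (0::'a). \<bar>\<phi> (norm x) / norm x - c\<bar> =
        norm (p_flux p ?U x - c *\<^sub>R x) / norm x"
      by (auto simp: eventually_at_filter)
  qed
  then have DV: "(p_flux p ?U has_derivative (\<lambda>h. c *\<^sub>R h)) (at 0)"
    unfolding has_derivative_at by (simp add: flux0 bounded_linear_scaleR_right)
  have "p_laplacian p ?U 0 = F 0"
    unfolding p_laplacian_def divergence_def frechet_derivative_at[OF DV, symmetric]
    by (simp add: c_def DIM)
  with off0 D0 DV show ?thesis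
    unfolding solves_p_laplace_def by (metis differentiableI norm_zero)
qed

lemma solves_system_radial:
  fixes u v :: "real \<Rightarrow> real"
  assumes sol: "solves_system p \<alpha> f G
    (\<lambda>x::'a::euclidean_space. u (norm x)) (\<lambda>x::'a. v (norm x))"
  shows "(u has_real_derivative 0) (at 0 within {0..})"
    and "(v has_real_derivative 0) (at 0 within {0..})"
    and "r > 0 \<Longrightarrow> u differentiable (at r)"
    and "r > 0 \<Longrightarrow> v differentiable (at r)"
    and "r > 0 \<Longrightarrow> ((\<lambda>r. r ^ (DIM('a) - 1) * (deriv u r * \<bar>deriv u r\<bar> powr (p - 2)))
      has_real_derivative r ^ (DIM('a) - 1) * (f 1 r * G 1 (v r) * rpow \<bar>deriv u r\<bar> \<alpha>)) (at r)"
    and "r > 0 \<Longrightarrow> ((\<lambda>r. r ^ (DIM('a) - 1) * (deriv v r * \<bar>deriv v r\<bar> powr (p - 2)))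
      has_real_derivative r ^ (DIM('a) - 1) * (f 2 r * G 2 (v r) * G 3 \<bar>deriv u r\<bar>)) (at r)"
proof -
  let ?U = "\<lambda>x::'a. u (norm x)" and ?V = "\<lambda>x::'a. v (norm x)"
  have dU: "\<And>x. ?U differentiable (at x)" and dV: "\<And>x. ?V differentiable (at x)"
    using sol by (auto simp: solves_system_def solves_p_laplace_def)
  note u = differentiable_radial[OF dU] and v = differentiable_radial[OF dV]
  show "(u has_real_derivative 0) (at 0 within {0..})"
    "(v has_real_derivative 0) (at 0 within {0..})"
    "r > 0 \<Longrightarrow> u differentiable (at r)" "r > 0 \<Longrightarrow> v differentiable (at r)"
    by (fact u v)+
  define w where "w r = (if r = 0 then norm (grad ?U 0) else \<bar>deriv u r\<bar>)" for r
  have w: "norm (grad ?U x) = w (norm x)" for x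
    by (cases "x = 0") (auto simp: w_def grad_radial u(2) norm_sgn)
  show "((\<lambda>r. r ^ (DIM('a) - 1) * (deriv u r * \<bar>deriv u r\<bar> powr (p - 2)))
      has_real_derivative r ^ (DIM('a) - 1) * (f 1 r * G 1 (v r) * rpow \<bar>deriv u r\<bar> \<alpha>)) (at r)"
    if "r > 0"
    using solves_p_laplace_radial[where 'a='a, of p u "\<lambda>r. f 1 r * G 1 (v r) * rpow (w r) \<alpha>" r]
      sol that by (simp add: solves_system_def w) (simp add: w_def)
  show "((\<lambda>r. r ^ (DIM('a) - 1) * (deriv v r * \<bar>deriv v r\<bar> powr (p - 2)))
      has_real_derivative r ^ (DIM('a) - 1) * (f 2 r * G 2 (v r) * G 3 \<bar>deriv u r\<bar>)) (at r)"
    if "r > 0"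
    using solves_p_laplace_radial[where 'a='a, of p v "\<lambda>r. f 2 r * G 2 (v r) * G 3 (w r)" r]
      sol that by (simp add: solves_system_def w) (simp add: w_def)
qed

end

theory Submission
  imports Defs
begin

text \<open>
  Both solutions blow up together with their derivatives, so only their behaviour near infinity
  matters, where \<open>g\<^sub>j\<close> and \<open>h\<^sub>j\<close> are interchangeable: by (B4) they are regularly varying of the same
  index \<open>k\<^sub>j\<close> and asymptotically equal. If \<open>v \<le> N v\<^sub>0\<close> near infinity, the first equation gives
  \<open>u' \<le> N\<^sup>\<kappa> u\<^sub>0'\<close> with \<open>\<kappa>\<close> close to \<open>k\<^sub>1 / (p - 1 - \<alpha>)\<close>, and the second gives \<open>v \<le> N\<^sup>\<theta> v\<^sub>0\<close> with \<open>\<theta>\<close>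
  close to \<open>(k\<^sub>2 + \<kappa> k\<^sub>3) / (p - 1)\<close>. The existence of a solution with \<open>u\<^sub>0(0) = v\<^sub>0(0) = 0\<close>, together
  with \<open>h\<^sub>j(t) \<le> g\<^sub>j(1) t\<^bsup>k\<^sub>j\<^esup>\<close> for small \<open>t\<close> (a consequence of (B3) and (B4)), forces \<open>\<alpha> < p - 1\<close> and
  \<open>\<theta> < 1\<close>. Iterating \<open>N \<mapsto> N\<^sup>\<theta>\<close> shows that the upper limits of all four quotients are at most \<open>1\<close>; exchanging
  the two solutions gives the lower limits. Monotonicity of the quotients is not available, since
  for \<open>\<alpha> > 0\<close> the derivative \<open>u'\<close> may vanish on an initial interval.
\<close>

section \<open>Comparison by integration, and quotients tending to one\<close>

lemma le_mult_of_deriv_le: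
  fixes X X\<^sub>0 :: "real \<Rightarrow> real"
  assumes "A \<le> r"
    and X: "\<And>s. A \<le> s \<Longrightarrow> s \<le> r \<Longrightarrow> (X has_real_derivative X' s) (at s)"
    and X0: "\<And>s. A \<le> s \<Longrightarrow> s \<le> r \<Longrightarrow> (X\<^sub>0 has_real_derivative X\<^sub>0' s) (at s)"
    and le: "\<And>s. A \<le> s \<Longrightarrow> s \<le> r \<Longrightarrow> X' s \<le> K * X\<^sub>0' s"
    and init: "X A \<le> K * X\<^sub>0 A"
  shows "X r \<le> K * X\<^sub>0 r"
proof -
  have "K * X\<^sub>0 A - X A \<le> K * X\<^sub>0 r - X r"
  proof (rule DERIV_nonneg_imp_nondecreasing[OF assms(1)])
    fix s assume s: "A \<le> s" "s \<le> r"
    have "((\<lambda>s. K * X\<^sub>0 s - X s) has_real_derivative K * X\<^sub>0' s - X' s) (at s)"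
      by (intro DERIV_diff DERIV_cmult X X0 s)
    then show "\<exists>y. ((\<lambda>s. K * X\<^sub>0 s - X s) has_real_derivative y) (at s) \<and> 0 \<le> y"
      using le[OF s] by force
  qed
  with init show ?thesis by simp
qed

text \<open>Integration leaves an additive constant. As \<open>X\<^sub>0\<close> tends to infinity,
  that constant is absorbed by enlarging \<open>K\<close> to any \<open>K'\<close> above it; this
  strict loss is the source of one \<epsilon> in the exponents below.\<close>

lemma eventually_le_mult_of_deriv_le:
  fixes X X\<^sub>0 :: "real \<Rightarrow> real"
  assumes X: "\<forall>\<^sub>F s in at_top. (X has_real_derivative X' s) (at s)"
    and X0: "\<forall>\<^sub>F s in at_top. (X\<^sub>0 has_real_derivative X\<^sub>0' s) (at s)"
    and le: "\<forall>\<^sub>F s in at_top. X' s \<le> K * X\<^sub>0' s"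
    and lim: "filterlim X\<^sub>0 at_top at_top" and K: "K < K'"
  shows "\<forall>\<^sub>F r in at_top. X r \<le> K' * X\<^sub>0 r"
proof -
  obtain A where A: "\<And>s. s \<ge> A \<Longrightarrow> (X has_real_derivative X' s) (at s) \<and>
      (X\<^sub>0 has_real_derivative X\<^sub>0' s) (at s) \<and> X' s \<le> K * X\<^sub>0' s"
    using eventually_conj[OF X eventually_conj[OF X0 le]] unfolding eventually_at_top_linorder by blast
  define c where "c = X A - K * X\<^sub>0 A"
  have *: "X r - c \<le> K * X\<^sub>0 r" if "A \<le> r" for r
  proof (rule le_mult_of_deriv_le[OF that, of "\<lambda>r. X r - c" X' X\<^sub>0 X\<^sub>0'])
    show "((\<lambda>r. X r - c) has_real_derivative X' s) (at s)" if "A \<le> s" for s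
      using A[OF that] by (auto intro!: derivative_eq_intros)
  qed (use A in \<open>auto simp: c_def\<close>)
  have "\<forall>\<^sub>F r in at_top. X\<^sub>0 r \<ge> c / (K' - K)"
    using lim by (simp add: filterlim_at_top)
  then show ?thesis using eventually_ge_at_top[of A]
  proof eventually_elim
    case (elim r)
    then have "c \<le> (K' - K) * X\<^sub>0 r" using K by (simp add: field_simps)
    with *[of r] elim show ?case by (simp add: algebra_simps)
  qed
qed

text \<open>Serves to pass from a bound between fluxes with a common weight \<open>c\<close> to one
  between derivatives.\<close>

lemma le_powr_root_mult:
  fixes x x\<^sub>0 a c K :: real
  assumes "c * x powr a \<le> K * (c * x\<^sub>0 powr a)" "c > 0" "x > 0" "x\<^sub>0 > 0" "a > 0" "K \<ge> 0"
  shows "x \<le> K powr (1 / a) * x\<^sub>0"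
proof -
  have "x powr a \<le> K * x\<^sub>0 powr a" using assms(1,2) by (simp add: mult.left_commute)
  then have "(x powr a) powr (1 / a) \<le> (K * x\<^sub>0 powr a) powr (1 / a)"
    using assms by (intro powr_mono2) auto
  then show ?thesis using assms by (simp add: powr_mult powr_powr)
qed

lemma filterlim_powr_cancel_at_top:
  fixes y :: "'a \<Rightarrow> real"
  assumes lim: "filterlim (\<lambda>r. y r powr a) at_top F" and a: "a > 0"
    and y: "\<forall>\<^sub>F r in F. y r \<ge> 0"
  shows "filterlim y at_top F"
  unfolding filterlim_at_top
proof
  fix M :: real
  have "\<forall>\<^sub>F r in F. y r powr a \<ge> \<bar>M\<bar> powr a" using lim by (simp add: filterlim_at_top)
  then show "\<forall>\<^sub>F r in F. M \<le> y r" using y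
  proof eventually_elim
    case (elim r)
    show ?case
    proof (rule ccontr)
      assume "\<not> M \<le> y r"
      then have "y r powr a < \<bar>M\<bar> powr a" using elim a by (intro powr_less_mono2) auto
      with elim show False by simp
    qed
  qed
qed

text \<open>An upper bound with the two functions exchanged takes the place of a lower bound, so
  that only upper estimates ever have to be proved.\<close>

lemma tendsto_divide_1I:
  fixes x x\<^sub>0 :: "'a \<Rightarrow> real"
  assumes le: "\<And>N. N > 1 \<Longrightarrow> \<forall>\<^sub>F r in F. x r \<le> N * x\<^sub>0 r"
    and ge: "\<And>N. N > 1 \<Longrightarrow> \<forall>\<^sub>F r in F. x\<^sub>0 r \<le> N * x r"
    and pos: "\<forall>\<^sub>F r in F. x\<^sub>0 r > 0"
  shows "((\<lambda>r. x r / x\<^sub>0 r) \<longlongrightarrow> 1) F"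
proof (rule order_tendstoI)
  fix b :: real assume b: "1 < b"
  then have "(1 + b) / 2 > 1" by simp
  from le[OF this] pos show "\<forall>\<^sub>F r in F. x r / x\<^sub>0 r < b"
  proof eventually_elim
    case (elim r)
    then have "x r / x\<^sub>0 r \<le> (1 + b) / 2" by (simp add: field_simps)
    also have "\<dots> < b" using b by simp
    finally show ?case .
  qed
next
  fix b :: real assume b: "b < 1"
  \<comment> \<open>\<open>1 / N = (1 + max b 0) / 2\<close> lies strictly between \<open>b\<close>
    and \<open>1\<close>; the maximum keeps it positive when \<open>b\<close> is negative.\<close>
  define N where "N = 2 / (1 + max b 0)"
  have N: "N > 1" using b by (auto simp: N_def field_simps)
  from ge[OF this] pos show "\<forall>\<^sub>F r in F. b < x r / x\<^sub>0 r"
  proof eventually_elim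
    case (elim r)
    have "b < (1 + max b 0) / 2" using b by (simp add: max_def)
    also have "\<dots> = 1 / N" by (simp add: N_def)
    also have "1 / N \<le> x r / x\<^sub>0 r" using N elim by (simp add: field_simps)
    finally show ?case .
  qed
qed

subsection \<open>Regularly varying pairs\<close>

text \<open>The case \<open>s = 1\<close> gives asymptotic equality of \<open>G\<close> and
  \<open>H\<close>, so both vary regularly with index \<open>k\<close>. Monotonicity is included
  because inequalities between arguments have to pass through the functions.\<close>

definition regular_pair :: "real \<Rightarrow> (real \<Rightarrow> real) \<Rightarrow> (real \<Rightarrow> real) \<Rightarrow> bool" where
  "regular_pair k G H \<longleftrightarrow> k \<ge> 0 \<and> (\<forall>t>0. G t > 0 \<and> H t > 0) \<and>
     mono_on {0<..} G \<and> mono_on {0<..} H \<and>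
     (\<forall>s\<ge>1. ((\<lambda>t. G (s * t) / H t) \<longlongrightarrow> s powr k) at_top)"

lemma regular_pair_mono: "regular_pair k G H \<Longrightarrow> 0 < s \<Longrightarrow> s \<le> t \<Longrightarrow> G s \<le> G t"
  by (auto simp: regular_pair_def mono_on_def)

text \<open>\<open>H (s * t) / G t\<close> is the product of \<open>H (s * t) / G (s * t)\<close>,
  \<open>G (s * t) / H t\<close> and \<open>H t / G t\<close>; the outer factors tend to
  \<open>1\<close> by the case \<open>s = 1\<close>. This makes the two solutions
  interchangeable.\<close>

lemma regular_pair_sym:
  assumes "regular_pair k G H" shows "regular_pair k H G"
proof -
  have G: "\<And>t. t > 0 \<Longrightarrow> G t > 0" and H: "\<And>t. t > 0 \<Longrightarrow> H t > 0"
    and lim: "\<And>s. s \<ge> 1 \<Longrightarrow> ((\<lambda>t. G (s * t) / H t) \<longlongrightarrow> s powr k) at_top"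
    using assms by (auto simp: regular_pair_def)
  have "((\<lambda>t. H (s * t) / G t) \<longlongrightarrow> s powr k) at_top" if s: "s \<ge> 1" for s
  proof -
    have HG: "((\<lambda>t. inverse (G (1 * t) / H t)) \<longlongrightarrow> inverse (1 powr k)) at_top"
      by (intro tendsto_inverse lim) auto
    have "filterlim (\<lambda>t. s * t) at_top at_top"
      using s by (intro filterlim_tendsto_pos_mult_at_top[OF tendsto_const]) (auto simp: filterlim_ident)
    from filterlim_compose[OF HG this] lim[OF s] HG
    have "((\<lambda>t. inverse (G (1 * (s * t)) / H (s * t)) * (G (s * t) / H t) * inverse (G (1 * t) / H t))
        \<longlongrightarrow> inverse (1 powr k) * s powr k * inverse (1 powr k)) at_top"
      by (intro tendsto_mult)
    then have "((\<lambda>t. inverse (G (1 * (s * t)) / H (s * t)) * (G (s * t) / H t) * inverse (G (1 * t) / H t))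
        \<longlongrightarrow> s powr k) at_top" by simp
    then show ?thesis
    proof (rule Lim_transform_eventually)
      show "\<forall>\<^sub>F t in at_top. inverse (G (1 * (s * t)) / H (s * t)) * (G (s * t) / H t) *
          inverse (G (1 * t) / H t) = H (s * t) / G t"
        using eventually_gt_at_top[of 0]
      proof eventually_elim
        case (elim t)
        then show ?case using G[of t] G[of "s * t"] H[of t] s by (simp add: field_simps)
      qed
    qed
  qed
  with assms show ?thesis by (auto simp: regular_pair_def)
qed

text \<open>For \<open>s > 1\<close> the limit \<open>s powr k\<close> lies strictly below
  \<open>s powr e\<close>, which leaves room for an inequality without a constant.\<close>

lemma regular_pair_eventually_le:
  assumes rp: "regular_pair k G H" and s: "s > 1" and e: "k < e"
  shows "\<forall>\<^sub>F t in at_top. G (s * t) \<le> s powr e * H t"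
proof -
  have "((\<lambda>t. G (s * t) / H t) \<longlongrightarrow> s powr k) at_top" "s powr k < s powr e"
    using rp s e by (auto simp: regular_pair_def intro: powr_less_mono)
  from order_tendstoD(2)[OF this] eventually_gt_at_top[of 0] show ?thesis
  proof eventually_elim
    case (elim t)
    then have "H t > 0" using rp by (simp add: regular_pair_def)
    then show ?case using elim by (simp add: field_simps)
  qed
qed

text \<open>Potter's bound, by dyadic iteration.\<close>

lemma regular_pair_potter:
  assumes rp: "regular_pair k G H" and e: "k < e"
  obtains C where "C \<ge> 1" "\<And>s t. s \<ge> 1 \<Longrightarrow> t \<ge> 1 \<Longrightarrow> G (s * t) \<le> C * s powr e * H t"
proof -
  have k: "k \<ge> 0" and pos: "\<And>t. t > 0 \<Longrightarrow> G t > 0 \<and> H t > 0"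
    using rp by (auto simp: regular_pair_def)
  note mono = regular_pair_mono[OF rp] regular_pair_mono[OF regular_pair_sym[OF rp]]
  have "((\<lambda>t. G (1 * t) / H t) \<longlongrightarrow> 1) at_top"
    using rp unfolding regular_pair_def by (metis order_refl powr_one_eq_one)
  from order_tendstoD(2)[OF this, of 2, simplified] eventually_ge_at_top[of 1]
  have "\<forall>\<^sub>F t in at_top. 1 \<le> t \<and> G t \<le> 2 * H t"
  proof eventually_elim
    case (elim t)
    then show ?case using pos[of t] by (simp add: field_simps)
  qed
  moreover
  \<comment> \<open>The doubling quotient \<open>G (2 * t) / G t\<close> is reached through
    \<open>H t\<close>; it tends to \<open>2 powr k\<close>, which is less than
    \<open>2 powr e\<close>.\<close>
  have "((\<lambda>t. G (2 * t) / H t * inverse (G (1 * t) / H t)) \<longlongrightarrow> 2 powr k * inverse (1 powr k)) at_top"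
    using rp by (intro tendsto_intros) (auto simp: regular_pair_def)
  then have "\<forall>\<^sub>F t in at_top. G (2 * t) / H t * inverse (G (1 * t) / H t) < 2 powr e"
    using e by (intro order_tendstoD(2)) auto
  ultimately have "\<forall>\<^sub>F t in at_top. 1 \<le> t \<and> G t \<le> 2 * H t \<and>
      G (2 * t) / H t * inverse (G (1 * t) / H t) < 2 powr e"
    by eventually_elim auto
  then obtain T where "\<And>t. t \<ge> T \<Longrightarrow> 1 \<le> t \<and> G t \<le> 2 * H t \<and>
      G (2 * t) / H t * inverse (G (1 * t) / H t) < 2 powr e"
    unfolding eventually_at_top_linorder by blast
  then have T: "1 \<le> T" "\<And>t. t \<ge> T \<Longrightarrow> G t \<le> 2 * H t"
    and T2: "\<And>t. t \<ge> T \<Longrightarrow> G (2 * t) / H t * inverse (G (1 * t) / H t) < 2 powr e"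
    by auto
  have dbl: "G (2 * t) \<le> 2 powr e * G t" if "t \<ge> T" for t
    using T2[OF that] that T pos[of t] by (simp add: field_simps)
  have iter: "G (2 ^ j * t) \<le> (2 powr e) ^ j * G t" if t: "t \<ge> T" for j t
  proof (induction j)
    case (Suc j)
    have "1 * t \<le> 2 ^ j * t" using t T by (intro mult_right_mono) auto
    then have "G (2 * (2 ^ j * t)) \<le> 2 powr e * G (2 ^ j * t)"
      using t by (intro dbl) auto
    also have "\<dots> \<le> 2 powr e * ((2 powr e) ^ j * G t)" by (intro mult_left_mono Suc.IH) auto
    finally show ?case by (simp add: mult.assoc)
  qed simp
  have big: "G (s * t) \<le> 2 powr e * s powr e * G t" if s: "s \<ge> 1" and t: "t \<ge> T" for s t
  proof -
    \<comment> \<open>Rounding \<open>s\<close> up to a power of two overshoots by a factor of at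
      most two, which costs \<open>2 powr e\<close>.\<close>
    define j where "j = nat \<lceil>log 2 s\<rceil>"
    have "log 2 s \<ge> 0" using s by simp
    then have j: "log 2 s \<le> j" "j \<le> log 2 s + 1" unfolding j_def by linarith+
    have "s = 2 powr log 2 s" using s by simp
    also have "\<dots> \<le> 2 powr j" using j by (intro powr_mono) auto
    finally have "s \<le> 2 ^ j" by (simp add: powr_realpow)
    then have "G (s * t) \<le> G (2 ^ j * t)" using s t T by (intro mono mult_right_mono) auto
    also have "\<dots> \<le> (2 powr e) ^ j * G t" by (rule iter[OF t])
    also have "(2 powr e) ^ j = (2 powr j) powr e"
      by (simp add: powr_realpow[symmetric] powr_powr mult.commute)
    finally have "G (s * t) \<le> (2 powr j) powr e * G t" .
    also have "2 powr j \<le> 2 powr (log 2 s + 1)" using j by (intro powr_mono) auto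
    then have "2 powr j \<le> 2 * s" using s by (simp add: powr_add)
    then have "(2 powr j) powr e * G t \<le> (2 * s) powr e * G t"
      using e k pos[of t] t T by (intro mult_right_mono powr_mono2) auto
    finally have "G (s * t) \<le> (2 * s) powr e * G t" .
    then show ?thesis using s by (simp add: powr_mult)
  qed
  \<comment> \<open>Here \<open>2 powr e\<close> pays for the rounding, \<open>2\<close> for passing
    from \<open>G\<close> to \<open>H\<close> beyond \<open>T\<close>, and \<open>G T / H 1\<close>
    for \<open>t\<close> between \<open>1\<close> and \<open>T\<close>.\<close>
  define C where "C = max 1 (2 powr e * (2 + G T / H 1))"
  have C2: "C \<ge> 2 powr e * (2 + G T / H 1)" by (simp add: C_def)
  show ?thesis
  proof
    show "C \<ge> 1" by (simp add: C_def)
    fix s t :: real assume s: "s \<ge> 1" and t: "t \<ge> 1"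
    define t' where "t' = max t T"
    have t': "t' \<ge> t" "t' \<ge> T" by (auto simp: t'_def)
    have Ht: "H 1 \<le> H t" "H 1 > 0" "H t > 0" using t pos by (auto intro: mono)
    have "G t' \<le> (2 + G T / H 1) * H t"
    proof (cases "t \<ge> T")
      case True
      then have "G t' \<le> 2 * H t" using T by (auto simp: t'_def)
      also have "\<dots> \<le> (2 + G T / H 1) * H t" using Ht pos[of T] T by (intro mult_right_mono) auto
      finally show ?thesis .
    next
      case False
      then have "G t' = G T / H 1 * H 1" using Ht by (auto simp: t'_def)
      also have "\<dots> \<le> (2 + G T / H 1) * H t" using Ht pos[of T] T by (intro mult_mono) auto
      finally show ?thesis .
    qed
    have "G (s * t) \<le> G (s * t')" using s t t' by (intro mono mult_left_mono) auto
    also have "\<dots> \<le> 2 powr e * s powr e * G t'" by (rule big[OF s t'(2)])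
    also have "\<dots> \<le> 2 powr e * s powr e * ((2 + G T / H 1) * H t)"
      by (intro mult_left_mono) (fact, simp)
    also have "\<dots> = (2 powr e * (2 + G T / H 1)) * (s powr e * H t)" by (simp add: mult_ac)
    also have "\<dots> \<le> C * (s powr e * H t)" using Ht by (intro mult_right_mono C2) auto
    finally show "G (s * t) \<le> C * s powr e * H t" by (simp add: mult.assoc)
  qed
qed

subsection \<open>Comparison of two solutions near infinity\<close>

text \<open>Common form of both solutions far out, with \<open>y\<close>, \<open>w\<close> the
  derivatives, \<open>a = p - 1 - \<alpha>\<close> and \<open>q = p - 1\<close>. The gradient power
  is already divided out of the first equation. The lower bounds by \<open>1\<close> are what
  Potter's bound asks for.\<close>

locale tail_solution =
  fixes c\<^sub>1 c\<^sub>2 \<omega>\<^sub>1 \<omega>\<^sub>2 :: "real \<Rightarrow> real" and a q :: real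
    and G\<^sub>1 G\<^sub>2 G\<^sub>3 u v y w :: "real \<Rightarrow> real" and A :: real
  assumes a: "a > 0" and q: "q > 0"
    and weights: "r \<ge> A \<Longrightarrow> c\<^sub>1 r > 0" "r \<ge> A \<Longrightarrow> c\<^sub>2 r > 0" "r \<ge> A \<Longrightarrow> \<omega>\<^sub>1 r \<ge> 0" "r \<ge> A \<Longrightarrow> \<omega>\<^sub>2 r \<ge> 0"
    and deriv_u: "r \<ge> A \<Longrightarrow> (u has_real_derivative y r) (at r)"
    and deriv_v: "r \<ge> A \<Longrightarrow> (v has_real_derivative w r) (at r)"
    and deriv_X: "r \<ge> A \<Longrightarrow>
      ((\<lambda>r. c\<^sub>1 r * y r powr a) has_real_derivative \<omega>\<^sub>1 r * G\<^sub>1 (v r)) (at r)"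
    and deriv_Z: "r \<ge> A \<Longrightarrow>
      ((\<lambda>r. c\<^sub>2 r * w r powr q) has_real_derivative \<omega>\<^sub>2 r * (G\<^sub>2 (v r) * G\<^sub>3 (y r))) (at r)"
    and ge1: "r \<ge> A \<Longrightarrow> u r \<ge> 1" "r \<ge> A \<Longrightarrow> v r \<ge> 1" "r \<ge> A \<Longrightarrow> y r \<ge> 1" "r \<ge> A \<Longrightarrow> w r \<ge> 1"
    and lim_u: "filterlim u at_top at_top" and lim_v: "filterlim v at_top at_top"
    and lim_y: "filterlim y at_top at_top"
    and lim_X: "filterlim (\<lambda>r. c\<^sub>1 r * y r powr a) at_top at_top"
    and lim_Z: "filterlim (\<lambda>r. c\<^sub>2 r * w r powr q) at_top at_top"

text \<open>Weights, exponents and starting point are shared, so the roles of the solutions can be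
  exchanged. \<open>subcritical\<close> says that the passage from \<open>v\<close> to
  \<open>y\<close> to \<open>w\<close> and back to \<open>v\<close> contracts exponents.\<close>

locale tail_comparison =
  s: tail_solution c\<^sub>1 c\<^sub>2 \<omega>\<^sub>1 \<omega>\<^sub>2 a q G\<^sub>1 G\<^sub>2 G\<^sub>3 u v y w A +
  s0: tail_solution c\<^sub>1 c\<^sub>2 \<omega>\<^sub>1 \<omega>\<^sub>2 a q H\<^sub>1 H\<^sub>2 H\<^sub>3 u\<^sub>0 v\<^sub>0 y\<^sub>0 w\<^sub>0 A
  for c\<^sub>1 c\<^sub>2 \<omega>\<^sub>1 \<omega>\<^sub>2 a q G\<^sub>1 G\<^sub>2 G\<^sub>3 u v y w A H\<^sub>1 H\<^sub>2 H\<^sub>3 u\<^sub>0 v\<^sub>0 y\<^sub>0 w\<^sub>0 +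
  fixes k\<^sub>1 k\<^sub>2 k\<^sub>3 :: real
  assumes rp1: "regular_pair k\<^sub>1 G\<^sub>1 H\<^sub>1" and rp2: "regular_pair k\<^sub>2 G\<^sub>2 H\<^sub>2"
    and rp3: "regular_pair k\<^sub>3 G\<^sub>3 H\<^sub>3"
    and subcritical: "k\<^sub>2 + k\<^sub>1 * k\<^sub>3 / a < q"
begin

lemma k_nonneg: "k\<^sub>1 \<ge> 0" "k\<^sub>2 \<ge> 0" "k\<^sub>3 \<ge> 0"
  using rp1 rp2 rp3 by (auto simp: regular_pair_def)

lemma G_pos: "t > 0 \<Longrightarrow> G\<^sub>1 t > 0" "t > 0 \<Longrightarrow> G\<^sub>2 t > 0" "t > 0 \<Longrightarrow> G\<^sub>3 t > 0"
  using rp1 rp2 rp3 by (auto simp: regular_pair_def)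

lemma H_pos: "t > 0 \<Longrightarrow> H\<^sub>1 t > 0" "t > 0 \<Longrightarrow> H\<^sub>2 t > 0" "t > 0 \<Longrightarrow> H\<^sub>3 t > 0"
  using rp1 rp2 rp3 by (auto simp: regular_pair_def)

lemma pos:
  assumes "r \<ge> A"
  shows "v r > 0" "y r > 0" "w r > 0" "v\<^sub>0 r > 0" "y\<^sub>0 r > 0" "w\<^sub>0 r > 0"
  using s.ge1[OF assms] s0.ge1[OF assms] by linarith+

text \<open>
  A bound \<open>v \<le> N v\<^sub>0\<close> propagates to \<open>y \<le> N\<^bsup>\<kappa> \<epsilon>\<^esup> y\<^sub>0\<close> and \<open>w \<le> N\<^bsup>\<mu> \<epsilon>\<^esup> w\<^sub>0\<close>; the extra \<open>\<epsilon>\<close>'s absorb the errors in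
  the asymptotic relations.
\<close>

definition \<kappa> :: "real \<Rightarrow> real" where "\<kappa> \<epsilon> = (k\<^sub>1 + 2 * \<epsilon>) / a"
definition \<mu> :: "real \<Rightarrow> real" where "\<mu> \<epsilon> = (k\<^sub>2 + \<epsilon> + (\<kappa> \<epsilon> * (k\<^sub>3 + \<epsilon>) + \<epsilon>) + \<epsilon>) / q"

text \<open>As \<epsilon> tends to \<open>0\<close> the value tends to
  \<open>(k\<^sub>2 + k\<^sub>1 * k\<^sub>3 / a) / q\<close>, which subcriticality puts below
  \<open>1\<close>. The added \<epsilon> will be spent on integrating \<open>w\<close>.\<close>

lemma exponent_exists: "\<exists>\<epsilon>>0. \<mu> \<epsilon> + \<epsilon> < 1"
proof -
  have "((\<lambda>\<epsilon>. \<mu> \<epsilon> + \<epsilon>) \<longlongrightarrow> (k\<^sub>2 + 0 + ((k\<^sub>1 + 2 * 0) / a * (k\<^sub>3 + 0) + 0) + 0) / q + 0) (at_right 0)"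
    unfolding \<mu>_def \<kappa>_def using s.a s.q by (intro tendsto_intros) auto
  moreover have "(k\<^sub>2 + 0 + ((k\<^sub>1 + 2 * 0) / a * (k\<^sub>3 + 0) + 0) + 0) / q + 0 < 1"
    using subcritical s.q by simp
  ultimately have "\<forall>\<^sub>F \<epsilon> in at_right 0. \<mu> \<epsilon> + \<epsilon> < 1" by (rule order_tendstoD)
  moreover have "\<forall>\<^sub>F \<epsilon> in at_right (0::real). \<epsilon> > 0" by (simp add: eventually_at_right_less)
  ultimately have "\<forall>\<^sub>F \<epsilon> in at_right 0. \<mu> \<epsilon> + \<epsilon> < 1 \<and> \<epsilon> > 0" by (rule eventually_conj)
  then show ?thesis using eventually_happens[of _ "at_right (0::real)"] by (auto simp: trivial_limit_at_right_real)
qed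

lemma \<kappa>_pos: "\<epsilon> > 0 \<Longrightarrow> \<kappa> \<epsilon> > 0"
  using k_nonneg s.a by (simp add: \<kappa>_def)

lemma \<mu>_pos: "\<epsilon> > 0 \<Longrightarrow> \<mu> \<epsilon> > 0"
  using k_nonneg s.q \<kappa>_pos[of \<epsilon>] unfolding \<mu>_def by (intro divide_pos_pos add_pos_pos add_nonneg_pos mult_pos_pos) auto

section \<open>A bound for \<open>v / v\<^sub>0\<close> on the whole half-line\<close>

text \<open>Potter's bounds hold from \<open>A\<close> on, so the equations can be integrated from
  \<open>A\<close>. What matters is that \<open>C\<close> depends neither on \<open>N\<close> nor on
  \<open>r\<close>.\<close>

lemma propagate_bound:
  assumes \<epsilon>: "\<epsilon> > 0"
  obtains C where "C \<ge> 1"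
    "\<And>N r. N \<ge> 1 \<Longrightarrow> r \<ge> A \<Longrightarrow> (\<And>s. A \<le> s \<Longrightarrow> s \<le> r \<Longrightarrow> v s \<le> N * v\<^sub>0 s) \<Longrightarrow>
      v r \<le> C * N powr \<mu> \<epsilon> * v\<^sub>0 r"
proof -
  obtain C1 where C1: "C1 \<ge> 1"
    "\<And>s t. s \<ge> 1 \<Longrightarrow> t \<ge> 1 \<Longrightarrow> G\<^sub>1 (s * t) \<le> C1 * s powr (k\<^sub>1 + \<epsilon>) * H\<^sub>1 t"
    by (rule regular_pair_potter[OF rp1, of "k\<^sub>1 + \<epsilon>"]) (use \<epsilon> in auto)
  obtain C2 where C2: "C2 \<ge> 1"
    "\<And>s t. s \<ge> 1 \<Longrightarrow> t \<ge> 1 \<Longrightarrow> G\<^sub>2 (s * t) \<le> C2 * s powr (k\<^sub>2 + \<epsilon>) * H\<^sub>2 t"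
    by (rule regular_pair_potter[OF rp2, of "k\<^sub>2 + \<epsilon>"]) (use \<epsilon> in auto)
  obtain C3 where C3: "C3 \<ge> 1"
    "\<And>s t. s \<ge> 1 \<Longrightarrow> t \<ge> 1 \<Longrightarrow> G\<^sub>3 (s * t) \<le> C3 * s powr (k\<^sub>3 + \<epsilon>) * H\<^sub>3 t"
    by (rule regular_pair_potter[OF rp3, of "k\<^sub>3 + \<epsilon>"]) (use \<epsilon> in auto)
  define X where "X = (\<lambda>r. c\<^sub>1 r * y r powr a)"
  define X0 where "X0 = (\<lambda>r. c\<^sub>1 r * y\<^sub>0 r powr a)"
  define Z where "Z = (\<lambda>r. c\<^sub>2 r * w r powr q)"
  define Z0 where "Z0 = (\<lambda>r. c\<^sub>2 r * w\<^sub>0 r powr q)"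
  have A: "X A > 0" "X0 A > 0" "Z A > 0" "Z0 A > 0" "v A > 0" "v\<^sub>0 A > 0"
    using s.weights[of A] pos[of A] by (auto simp: X_def X0_def Z_def Z0_def)
  \<comment> \<open>Adding the initial quotient at \<open>A\<close> to the factor in the derivatives
    yields one constant that serves both hypotheses of the comparison; \<open>E2\<close> and
    \<open>C\<close> are formed in the same way.\<close>
  define E1 where "E1 = C1 + X A / X0 A"
  have "X A / X0 A > 0" using A by simp
  then have E1: "E1 \<ge> C1" "E1 \<ge> X A / X0 A" "E1 \<ge> 1" using C1(1) by (auto simp: E1_def)
  define D1 where "D1 = E1 powr (1 / a)"
  have D1: "D1 \<ge> 1" using E1 s.a by (simp add: D1_def ge_one_powr_ge_zero)
  define F where "F = C2 * (C3 * D1 powr (k\<^sub>3 + \<epsilon>))"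
  have F: "F \<ge> 0" using C2(1) C3(1) by (simp add: F_def)
  define E2 where "E2 = F + Z A / Z0 A + 1"
  have E2: "E2 \<ge> F" "E2 \<ge> Z A / Z0 A" "E2 \<ge> 1" using A F by (auto simp: E2_def)
  define D2 where "D2 = E2 powr (1 / q)"
  have D2: "D2 \<ge> 1" using E2 s.q by (simp add: D2_def ge_one_powr_ge_zero)
  define C where "C = D2 + v A / v\<^sub>0 A"
  have "v A / v\<^sub>0 A > 0" using A by simp
  then have C: "C \<ge> D2" "C \<ge> v A / v\<^sub>0 A" "C \<ge> 1" using D2 by (auto simp: C_def)
  show thesis
  proof (rule that[OF C(3)])
    fix N r assume N: "N \<ge> 1" and r: "r \<ge> A"
      and le: "\<And>s. A \<le> s \<Longrightarrow> s \<le> r \<Longrightarrow> v s \<le> N * v\<^sub>0 s"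
    have Npow: "N powr e \<ge> 1" if "e \<ge> 0" for e using N that by (rule ge_one_powr_ge_zero)
    have X: "X s \<le> E1 * N powr (k\<^sub>1 + \<epsilon>) * X0 s" if s: "A \<le> s" "s \<le> r" for s
    proof (rule le_mult_of_deriv_le[OF s(1)])
      fix t assume t: "A \<le> t" "t \<le> s"
      show "(X has_real_derivative \<omega>\<^sub>1 t * G\<^sub>1 (v t)) (at t)"
        "(X0 has_real_derivative \<omega>\<^sub>1 t * H\<^sub>1 (v\<^sub>0 t)) (at t)"
        unfolding X_def X0_def using t s.deriv_X s0.deriv_X by auto
      have "G\<^sub>1 (v t) \<le> G\<^sub>1 (N * v\<^sub>0 t)"
        using pos[OF t(1)] le[of t] t s by (intro regular_pair_mono[OF rp1]) auto
      also have "\<dots> \<le> C1 * N powr (k\<^sub>1 + \<epsilon>) * H\<^sub>1 (v\<^sub>0 t)"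
        using N s0.ge1[OF t(1)] by (intro C1(2)) auto
      also have "\<dots> \<le> E1 * N powr (k\<^sub>1 + \<epsilon>) * H\<^sub>1 (v\<^sub>0 t)"
        using E1 H_pos(1)[of "v\<^sub>0 t"] pos[OF t(1)] by (intro mult_right_mono) auto
      finally have "\<omega>\<^sub>1 t * G\<^sub>1 (v t) \<le> \<omega>\<^sub>1 t * (E1 * N powr (k\<^sub>1 + \<epsilon>) * H\<^sub>1 (v\<^sub>0 t))"
        using s.weights[OF t(1)] by (intro mult_left_mono)
      then show "\<omega>\<^sub>1 t * G\<^sub>1 (v t) \<le> E1 * N powr (k\<^sub>1 + \<epsilon>) * (\<omega>\<^sub>1 t * H\<^sub>1 (v\<^sub>0 t))"
        by (simp add: mult_ac)
    next
      have "X A = X A / X0 A * 1 * X0 A" using A by simp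
      also have "\<dots> \<le> E1 * N powr (k\<^sub>1 + \<epsilon>) * X0 A"
        using A E1 Npow[of "k\<^sub>1 + \<epsilon>"] k_nonneg \<epsilon> by (intro mult_right_mono mult_mono) auto
      finally show "X A \<le> E1 * N powr (k\<^sub>1 + \<epsilon>) * X0 A" .
    qed
    have y: "y s \<le> D1 * N powr \<kappa> \<epsilon> * y\<^sub>0 s" if s: "A \<le> s" "s \<le> r" for s
    proof -
      have "y s \<le> (E1 * N powr (k\<^sub>1 + \<epsilon>)) powr (1 / a) * y\<^sub>0 s"
        using X[OF s] E1 s.weights[OF s(1)] pos[OF s(1)] s.a unfolding X_def X0_def
        by (intro le_powr_root_mult) auto
      also have "(E1 * N powr (k\<^sub>1 + \<epsilon>)) powr (1 / a) = D1 * N powr ((k\<^sub>1 + \<epsilon>) / a)"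
        using E1 by (simp add: powr_mult powr_powr D1_def)
      also have "\<dots> * y\<^sub>0 s \<le> D1 * N powr \<kappa> \<epsilon> * y\<^sub>0 s"
        using D1 N s.a \<epsilon> pos[OF s(1)] unfolding \<kappa>_def
        by (intro mult_right_mono mult_left_mono powr_mono divide_right_mono) auto
      finally show ?thesis .
    qed
    \<comment> \<open>Potter's bound for \<open>G\<^sub>3\<close> needs a scaling factor of at least
      \<open>1\<close>.\<close>
    have Dk: "D1 * N powr \<kappa> \<epsilon> \<ge> 1"
      using mult_mono[of 1 D1 1 "N powr \<kappa> \<epsilon>"] D1 Npow[of "\<kappa> \<epsilon>"] \<kappa>_pos[OF \<epsilon>] by simp
    define e where "e = k\<^sub>2 + \<epsilon> + \<kappa> \<epsilon> * (k\<^sub>3 + \<epsilon>)"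
    have e: "e \<ge> 0" using k_nonneg \<epsilon> \<kappa>_pos[OF \<epsilon>] by (simp add: e_def)
    have Z: "Z s \<le> E2 * N powr e * Z0 s" if s: "A \<le> s" "s \<le> r" for s
    proof (rule le_mult_of_deriv_le[OF s(1)])
      fix t assume t: "A \<le> t" "t \<le> s"
      show "(Z has_real_derivative \<omega>\<^sub>2 t * (G\<^sub>2 (v t) * G\<^sub>3 (y t))) (at t)"
        "(Z0 has_real_derivative \<omega>\<^sub>2 t * (H\<^sub>2 (v\<^sub>0 t) * H\<^sub>3 (y\<^sub>0 t))) (at t)"
        unfolding Z_def Z0_def using t s.deriv_Z s0.deriv_Z by auto
      note Hp = H_pos(2)[OF pos(4)[OF t(1)]] H_pos(3)[OF pos(5)[OF t(1)]]
      have "G\<^sub>2 (v t) \<le> G\<^sub>2 (N * v\<^sub>0 t)"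
        using pos[OF t(1)] le[of t] t s by (intro regular_pair_mono[OF rp2]) auto
      also have "\<dots> \<le> C2 * N powr (k\<^sub>2 + \<epsilon>) * H\<^sub>2 (v\<^sub>0 t)"
        using N s0.ge1[OF t(1)] by (intro C2(2)) auto
      finally have G2: "G\<^sub>2 (v t) \<le> C2 * N powr (k\<^sub>2 + \<epsilon>) * H\<^sub>2 (v\<^sub>0 t)" .
      have "G\<^sub>3 (y t) \<le> G\<^sub>3 (D1 * N powr \<kappa> \<epsilon> * y\<^sub>0 t)"
        using pos[OF t(1)] y[of t] t s by (intro regular_pair_mono[OF rp3]) auto
      also have "\<dots> \<le> C3 * (D1 * N powr \<kappa> \<epsilon>) powr (k\<^sub>3 + \<epsilon>) * H\<^sub>3 (y\<^sub>0 t)"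
        using Dk s0.ge1[OF t(1)] by (intro C3(2)) auto
      also have "(D1 * N powr \<kappa> \<epsilon>) powr (k\<^sub>3 + \<epsilon>) = D1 powr (k\<^sub>3 + \<epsilon>) * N powr (\<kappa> \<epsilon> * (k\<^sub>3 + \<epsilon>))"
        using D1 by (simp add: powr_mult powr_powr)
      finally have G3: "G\<^sub>3 (y t) \<le> C3 * (D1 powr (k\<^sub>3 + \<epsilon>) * N powr (\<kappa> \<epsilon> * (k\<^sub>3 + \<epsilon>))) * H\<^sub>3 (y\<^sub>0 t)" .
      have "G\<^sub>2 (v t) * G\<^sub>3 (y t) \<le> (C2 * N powr (k\<^sub>2 + \<epsilon>) * H\<^sub>2 (v\<^sub>0 t)) *
          (C3 * (D1 powr (k\<^sub>3 + \<epsilon>) * N powr (\<kappa> \<epsilon> * (k\<^sub>3 + \<epsilon>))) * H\<^sub>3 (y\<^sub>0 t))"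
        using G2 G3 G_pos(3)[of "y t"] pos[OF t(1)] C2(1) Hp by (intro mult_mono) auto
      also have "\<dots> = F * N powr e * (H\<^sub>2 (v\<^sub>0 t) * H\<^sub>3 (y\<^sub>0 t))"
        by (simp add: F_def e_def powr_add mult_ac)
      also have "\<dots> \<le> E2 * N powr e * (H\<^sub>2 (v\<^sub>0 t) * H\<^sub>3 (y\<^sub>0 t))"
        using E2 Hp by (intro mult_right_mono) auto
      finally have "\<omega>\<^sub>2 t * (G\<^sub>2 (v t) * G\<^sub>3 (y t)) \<le> \<omega>\<^sub>2 t * (E2 * N powr e * (H\<^sub>2 (v\<^sub>0 t) * H\<^sub>3 (y\<^sub>0 t)))"
        using s.weights[OF t(1)] by (intro mult_left_mono)
      then show "\<omega>\<^sub>2 t * (G\<^sub>2 (v t) * G\<^sub>3 (y t)) \<le> E2 * N powr e * (\<omega>\<^sub>2 t * (H\<^sub>2 (v\<^sub>0 t) * H\<^sub>3 (y\<^sub>0 t)))"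
        by (simp add: mult_ac)
    next
      have "Z A = Z A / Z0 A * 1 * Z0 A" using A by simp
      also have "\<dots> \<le> E2 * N powr e * Z0 A"
        using A E2 Npow[OF e] by (intro mult_right_mono mult_mono) auto
      finally show "Z A \<le> E2 * N powr e * Z0 A" .
    qed
    have w: "w s \<le> C * N powr \<mu> \<epsilon> * w\<^sub>0 s" if s: "A \<le> s" "s \<le> r" for s
    proof -
      have "w s \<le> (E2 * N powr e) powr (1 / q) * w\<^sub>0 s"
        using Z[OF s] E2 s.weights[OF s(1)] pos[OF s(1)] s.q unfolding Z_def Z0_def
        by (intro le_powr_root_mult) auto
      also have "(E2 * N powr e) powr (1 / q) = D2 * N powr (e / q)"
        using E2 by (simp add: powr_mult powr_powr D2_def)
      also have "\<dots> * w\<^sub>0 s \<le> C * N powr \<mu> \<epsilon> * w\<^sub>0 s"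
        using C D2 N s.q \<epsilon> pos[OF s(1)] unfolding \<mu>_def e_def
        by (intro mult_right_mono mult_mono powr_mono divide_right_mono) auto
      finally show ?thesis .
    qed
    show "v r \<le> C * N powr \<mu> \<epsilon> * v\<^sub>0 r"
    proof (rule le_mult_of_deriv_le[OF r s.deriv_v s0.deriv_v w])
      have "v A = v A / v\<^sub>0 A * 1 * v\<^sub>0 A" using A by simp
      also have "\<dots> \<le> C * N powr \<mu> \<epsilon> * v\<^sub>0 A"
        using A C Npow[of "\<mu> \<epsilon>"] \<mu>_pos[OF \<epsilon>] by (intro mult_right_mono mult_mono) auto
      finally show "v A \<le> C * N powr \<mu> \<epsilon> * v\<^sub>0 A" .
    qed
  qed
qed

text \<open>
  On \<open>[A, r]\<close> the best constant \<open>N\<close> in \<open>v \<le> N v\<^sub>0\<close> satisfies \<open>N \<le> C N\<^sup>\<mu>\<close> with \<open>\<mu> < 1\<close>, which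
  bounds it independently of \<open>r\<close>.
\<close>

lemma ratio_bounded:
  obtains N where "N \<ge> 1" "\<And>r. r \<ge> A \<Longrightarrow> v r \<le> N * v\<^sub>0 r"
proof -
  obtain \<epsilon> where \<epsilon>: "\<epsilon> > 0" "\<mu> \<epsilon> + \<epsilon> < 1" using exponent_exists by blast
  then have \<mu>: "\<mu> \<epsilon> < 1" by simp
  obtain C where C: "C \<ge> 1"
    "\<And>N r. N \<ge> 1 \<Longrightarrow> r \<ge> A \<Longrightarrow> (\<And>s. A \<le> s \<Longrightarrow> s \<le> r \<Longrightarrow> v s \<le> N * v\<^sub>0 s) \<Longrightarrow>
      v r \<le> C * N powr \<mu> \<epsilon> * v\<^sub>0 r"
    by (rule propagate_bound[OF \<epsilon>(1)]) (rule that, assumption, blast)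
  \<comment> \<open>The positive solution of \<open>N = C * N powr \<mu> \<epsilon>\<close>.\<close>
  define N where "N = C powr (1 / (1 - \<mu> \<epsilon>))"
  have N: "N \<ge> 1" using C(1) \<mu> by (simp add: N_def ge_one_powr_ge_zero)
  show thesis
  proof (rule that[OF N])
    fix r assume r: "r \<ge> A"
    have "continuous_on {A..r} v" "continuous_on {A..r} v\<^sub>0"
      using s.deriv_v s0.deriv_v
      by (auto intro!: continuous_at_imp_continuous_on DERIV_isCont)
    then have "continuous_on {A..r} (\<lambda>t. v t / v\<^sub>0 t)"
      using pos(4) by (intro continuous_on_divide) (auto simp: less_imp_neq[THEN not_sym])
    from continuous_attains_sup[OF _ _ this] r obtain t where
      t: "A \<le> t" "t \<le> r" "\<And>s. A \<le> s \<Longrightarrow> s \<le> r \<Longrightarrow> v s / v\<^sub>0 s \<le> v t / v\<^sub>0 t" by auto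
    \<comment> \<open>The best constant on \<open>[A, r]\<close>. Being attained at
      \<open>t\<close>, it can be compared with \<open>C * M powr \<mu> \<epsilon>\<close> by
      propagating the bound up to \<open>t\<close>.\<close>
    define M where "M = v t / v\<^sub>0 t"
    have M: "v s \<le> M * v\<^sub>0 s" if "A \<le> s" "s \<le> r" for s
      using t(3)[OF that] pos(4)[OF that(1)] by (simp add: M_def[symmetric] field_simps)
    have "M \<le> N"
    proof (cases "M \<le> 1")
      case False
      then have M1: "M > 1" by simp
      have "v t \<le> C * M powr \<mu> \<epsilon> * v\<^sub>0 t"
        by (rule C(2)) (use M1 t M in auto)
      then have "M \<le> C * M powr \<mu> \<epsilon>" using pos(4)[OF t(1)] by (simp add: M_def field_simps)
      moreover have "M powr (1 - \<mu> \<epsilon>) * M powr \<mu> \<epsilon> = M" using M1 by (simp add: powr_add[symmetric])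
      ultimately have "M powr (1 - \<mu> \<epsilon>) * M powr \<mu> \<epsilon> \<le> C * M powr \<mu> \<epsilon>" by simp
      then have "M powr (1 - \<mu> \<epsilon>) \<le> C" using M1 by simp
      then have "(M powr (1 - \<mu> \<epsilon>)) powr (1 / (1 - \<mu> \<epsilon>)) \<le> N"
        unfolding N_def using \<mu> by (intro powr_mono2) auto
      then show ?thesis using \<mu> M1 by (simp add: powr_powr)
    qed (use N in simp)
    then have "M * v\<^sub>0 r \<le> N * v\<^sub>0 r" using pos(4)[OF r] by (intro mult_right_mono) auto
    with M[of r] r show "v r \<le> N * v\<^sub>0 r" by simp
  qed
qed

section \<open>Improving the constant to any number above one\<close>

lemma ev_ge_A: "\<forall>\<^sub>F r in at_top. r \<ge> A" by (rule eventually_ge_at_top)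

text \<open>One \<epsilon> comes from regular variation and one from the constant of integration,
  hence \<open>2 * \<epsilon>\<close> in \<open>\<kappa>\<close>. In contrast to
  \<open>propagate_bound\<close> no factor \<open>C\<close> appears, as only large \<open>r\<close>
  count.\<close>

lemma step_y:
  assumes \<epsilon>: "\<epsilon> > 0" and N: "N > 1" and le: "\<forall>\<^sub>F r in at_top. v r \<le> N * v\<^sub>0 r"
  shows "\<forall>\<^sub>F r in at_top. y r \<le> N powr \<kappa> \<epsilon> * y\<^sub>0 r"
proof -
  have "\<forall>\<^sub>F r in at_top. G\<^sub>1 (N * v\<^sub>0 r) \<le> N powr (k\<^sub>1 + \<epsilon>) * H\<^sub>1 (v\<^sub>0 r)"
    by (rule eventually_compose_filterlim[OF regular_pair_eventually_le[OF rp1 N] s0.lim_v]) (use \<epsilon> in simp)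
  then have "\<forall>\<^sub>F r in at_top. \<omega>\<^sub>1 r * G\<^sub>1 (v r) \<le> N powr (k\<^sub>1 + \<epsilon>) * (\<omega>\<^sub>1 r * H\<^sub>1 (v\<^sub>0 r))"
    using le ev_ge_A
  proof eventually_elim
    case (elim r)
    have "G\<^sub>1 (v r) \<le> G\<^sub>1 (N * v\<^sub>0 r)" using pos[OF elim(3)] elim(2) by (intro regular_pair_mono[OF rp1]) auto
    with elim(1) have "G\<^sub>1 (v r) \<le> N powr (k\<^sub>1 + \<epsilon>) * H\<^sub>1 (v\<^sub>0 r)" by linarith
    from mult_left_mono[OF this s.weights(3)[OF elim(3)]] show ?case by (simp add: mult_ac)
  qed
  then have "\<forall>\<^sub>F r in at_top. c\<^sub>1 r * y r powr a \<le> N powr (k\<^sub>1 + 2 * \<epsilon>) * (c\<^sub>1 r * y\<^sub>0 r powr a)"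
    using N \<epsilon> s.deriv_X s0.deriv_X
    by (intro eventually_le_mult_of_deriv_le[OF _ _ _ s0.lim_X])
      (auto intro: powr_less_mono eventually_mono[OF ev_ge_A])
  then show ?thesis using ev_ge_A
  proof eventually_elim
    case (elim r)
    have "y r \<le> (N powr (k\<^sub>1 + 2 * \<epsilon>)) powr (1 / a) * y\<^sub>0 r"
      using elim pos[of r] s.weights[of r] s.a by (intro le_powr_root_mult) auto
    then show ?case by (simp add: powr_powr \<kappa>_def)
  qed
qed

lemma step_w:
  assumes \<epsilon>: "\<epsilon> > 0" and N: "N > 1" and le: "\<forall>\<^sub>F r in at_top. v r \<le> N * v\<^sub>0 r"
  shows "\<forall>\<^sub>F r in at_top. w r \<le> N powr \<mu> \<epsilon> * w\<^sub>0 r"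
proof -
  have N\<kappa>: "N powr \<kappa> \<epsilon> > 1" using N \<kappa>_pos[OF \<epsilon>] by simp
  \<comment> \<open>The last \<epsilon> pays for the integration; \<open>\<mu> \<epsilon>\<close> is
    larger still than \<open>e / q\<close>.\<close>
  define e where "e = k\<^sub>2 + \<epsilon> + (\<kappa> \<epsilon> * (k\<^sub>3 + \<epsilon>) + \<epsilon>)"
  have "\<forall>\<^sub>F r in at_top. G\<^sub>2 (N * v\<^sub>0 r) \<le> N powr (k\<^sub>2 + \<epsilon>) * H\<^sub>2 (v\<^sub>0 r)"
    by (rule eventually_compose_filterlim[OF regular_pair_eventually_le[OF rp2 N] s0.lim_v]) (use \<epsilon> in simp)
  moreover have "\<forall>\<^sub>F r in at_top. G\<^sub>3 (N powr \<kappa> \<epsilon> * y\<^sub>0 r) \<le> (N powr \<kappa> \<epsilon>) powr (k\<^sub>3 + \<epsilon>) * H\<^sub>3 (y\<^sub>0 r)"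
    by (rule eventually_compose_filterlim[OF regular_pair_eventually_le[OF rp3 N\<kappa>] s0.lim_y]) (use \<epsilon> in simp)
  ultimately have "\<forall>\<^sub>F r in at_top. \<omega>\<^sub>2 r * (G\<^sub>2 (v r) * G\<^sub>3 (y r)) \<le>
      N powr (k\<^sub>2 + \<epsilon> + \<kappa> \<epsilon> * (k\<^sub>3 + \<epsilon>)) * (\<omega>\<^sub>2 r * (H\<^sub>2 (v\<^sub>0 r) * H\<^sub>3 (y\<^sub>0 r)))"
    using le step_y[OF assms] ev_ge_A
  proof eventually_elim
    case (elim r)
    note p = pos[OF elim(5)]
    have "G\<^sub>2 (v r) \<le> G\<^sub>2 (N * v\<^sub>0 r)" using p elim by (intro regular_pair_mono[OF rp2]) auto
    with elim(1) have 2: "G\<^sub>2 (v r) \<le> N powr (k\<^sub>2 + \<epsilon>) * H\<^sub>2 (v\<^sub>0 r)" by linarith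
    have "G\<^sub>3 (y r) \<le> G\<^sub>3 (N powr \<kappa> \<epsilon> * y\<^sub>0 r)" using p elim by (intro regular_pair_mono[OF rp3]) auto
    with elim(2) have 3: "G\<^sub>3 (y r) \<le> N powr (\<kappa> \<epsilon> * (k\<^sub>3 + \<epsilon>)) * H\<^sub>3 (y\<^sub>0 r)" by (simp add: powr_powr)
    have "G\<^sub>2 (v r) * G\<^sub>3 (y r) \<le> (N powr (k\<^sub>2 + \<epsilon>) * H\<^sub>2 (v\<^sub>0 r)) * (N powr (\<kappa> \<epsilon> * (k\<^sub>3 + \<epsilon>)) * H\<^sub>3 (y\<^sub>0 r))"
      using 2 3 G_pos(3)[OF p(2)] H_pos(2)[OF p(4)] by (intro mult_mono) auto
    from mult_left_mono[OF this s.weights(4)[OF elim(5)]] show ?case by (simp add: powr_add mult_ac)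
  qed
  then have "\<forall>\<^sub>F r in at_top. c\<^sub>2 r * w r powr q \<le> N powr e * (c\<^sub>2 r * w\<^sub>0 r powr q)"
    using N \<epsilon> s.deriv_Z s0.deriv_Z unfolding e_def
    by (intro eventually_le_mult_of_deriv_le[OF _ _ _ s0.lim_Z])
      (auto intro: powr_less_mono eventually_mono[OF ev_ge_A])
  then show ?thesis using ev_ge_A
  proof eventually_elim
    case (elim r)
    have "w r \<le> (N powr e) powr (1 / q) * w\<^sub>0 r"
      using elim pos[of r] s.weights[of r] s.q by (intro le_powr_root_mult) auto
    also have "\<dots> \<le> N powr \<mu> \<epsilon> * w\<^sub>0 r"
      using N \<epsilon> s.q pos[OF elim(2)] unfolding \<mu>_def e_def powr_powr
      by (intro mult_right_mono powr_mono) (auto simp: field_simps)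
    finally show ?case .
  qed
qed

text \<open>Closes the loop from \<open>v\<close> back to \<open>v\<close>, with a total exponent
  that \<open>exponent_exists\<close> makes smaller than \<open>1\<close>.\<close>

lemma step_v:
  assumes \<epsilon>: "\<epsilon> > 0" and N: "N > 1" and le: "\<forall>\<^sub>F r in at_top. v r \<le> N * v\<^sub>0 r"
  shows "\<forall>\<^sub>F r in at_top. v r \<le> N powr (\<mu> \<epsilon> + \<epsilon>) * v\<^sub>0 r"
  using N \<epsilon> s.deriv_v s0.deriv_v
  by (intro eventually_le_mult_of_deriv_le[OF _ _ step_w[OF assms] s0.lim_v])
    (auto intro: powr_less_mono eventually_mono[OF ev_ge_A])

text \<open>\<open>ratio_bounded\<close> seeds the iteration. After \<open>j\<close> rounds the seed
  carries the exponent \<open>\<theta> ^ j\<close>, which tends to \<open>0\<close>, so the constant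
  drops below every \<open>N > 1\<close>.\<close>

lemma v_le:
  assumes N: "N > 1" shows "\<forall>\<^sub>F r in at_top. v r \<le> N * v\<^sub>0 r"
proof -
  obtain \<epsilon> where \<epsilon>: "\<epsilon> > 0" "\<mu> \<epsilon> + \<epsilon> < 1" using exponent_exists by blast
  define \<theta> where "\<theta> = \<mu> \<epsilon> + \<epsilon>"
  have \<theta>: "0 < \<theta>" "\<theta> < 1" using \<mu>_pos[OF \<epsilon>(1)] \<epsilon> by (auto simp: \<theta>_def)
  obtain M' where M': "M' \<ge> 1" "\<And>r. r \<ge> A \<Longrightarrow> v r \<le> M' * v\<^sub>0 r" by (rule ratio_bounded) auto
  \<comment> \<open>Adding \<open>1\<close> makes the seed strictly larger than one, as each round
    requires.\<close>
  define M where "M = M' + 1"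
  have M: "M > 1" using M' by (simp add: M_def)
  have *: "\<forall>\<^sub>F r in at_top. v r \<le> M powr (\<theta> ^ j) * v\<^sub>0 r" for j
  proof (induction j)
    case 0
    show ?case using ev_ge_A
    proof eventually_elim
      case (elim r)
      then show ?case using M'(2)[of r] pos(4)[of r] M by (simp add: M_def algebra_simps)
    qed
  next
    case (Suc j)
    from step_v[OF \<epsilon>(1) _ Suc] M \<theta> show ?case
      by (simp add: \<theta>_def[symmetric] powr_powr mult.commute)
  qed
  have "(\<lambda>j. M powr (\<theta> ^ j)) \<longlonglongrightarrow> M powr 0"
    using \<theta> M by (intro tendsto_powr tendsto_const LIMSEQ_realpow_zero) auto
  with N M have "\<forall>\<^sub>F j in sequentially. M powr (\<theta> ^ j) < N" by (intro order_tendstoD) auto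
  then obtain j where j: "M powr (\<theta> ^ j) < N" by (auto simp: eventually_sequentially)
  from *[of j] ev_ge_A show ?thesis
  proof eventually_elim
    case (elim r)
    have "M powr (\<theta> ^ j) * v\<^sub>0 r \<le> N * v\<^sub>0 r" using j pos(4)[OF elim(2)] by (intro mult_right_mono) auto
    with elim show ?case by linarith
  qed
qed

text \<open>Since \<open>v_le\<close> allows every constant above \<open>1\<close>, a fixed exponent
  does no harm: \<open>\<epsilon> = 1\<close> and the constant
  \<open>N powr (1 / \<kappa> 1)\<close> for \<open>v\<close> give exactly \<open>N\<close>.\<close>

lemma y_le:
  assumes N: "N > 1" shows "\<forall>\<^sub>F r in at_top. y r \<le> N * y\<^sub>0 r"
proof -
  have \<kappa>: "\<kappa> 1 > 0" by (simp add: \<kappa>_pos)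
  then have "N powr (1 / \<kappa> 1) > 1" using N by simp
  from step_y[OF zero_less_one this v_le[OF this]] show ?thesis using \<kappa> N by (simp add: powr_powr)
qed

lemma w_le:
  assumes N: "N > 1" shows "\<forall>\<^sub>F r in at_top. w r \<le> N * w\<^sub>0 r"
proof -
  have \<mu>: "\<mu> 1 > 0" by (simp add: \<mu>_pos)
  then have "N powr (1 / \<mu> 1) > 1" using N by simp
  from step_w[OF zero_less_one this v_le[OF this]] show ?thesis using \<mu> N by (simp add: powr_powr)
qed

lemma u_le:
  assumes N: "N > 1" shows "\<forall>\<^sub>F r in at_top. u r \<le> N * u\<^sub>0 r"
proof (rule eventually_le_mult_of_deriv_le[OF _ _ y_le s0.lim_u])
  show "1 < (1 + N) / 2" "(1 + N) / 2 < N" using N by auto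
  show "\<forall>\<^sub>F r in at_top. (u has_real_derivative y r) (at r)"
    "\<forall>\<^sub>F r in at_top. (u\<^sub>0 has_real_derivative y\<^sub>0 r) (at r)"
    by (rule eventually_mono[OF ev_ge_A]; simp add: s.deriv_u s0.deriv_u)+
qed

end

lemma tail_asymptotics:
  assumes c: "tail_comparison c\<^sub>1 c\<^sub>2 \<omega>\<^sub>1 \<omega>\<^sub>2 a q G\<^sub>1 G\<^sub>2 G\<^sub>3 u v y w A H\<^sub>1 H\<^sub>2 H\<^sub>3 u\<^sub>0 v\<^sub>0 y\<^sub>0 w\<^sub>0 k\<^sub>1 k\<^sub>2 k\<^sub>3"
  shows "((\<lambda>r. u r / u\<^sub>0 r) \<longlongrightarrow> 1) at_top" "((\<lambda>r. v r / v\<^sub>0 r) \<longlongrightarrow> 1) at_top"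
    "((\<lambda>r. y r / y\<^sub>0 r) \<longlongrightarrow> 1) at_top" "((\<lambda>r. w r / w\<^sub>0 r) \<longlongrightarrow> 1) at_top"
proof -
  interpret c1: tail_comparison c\<^sub>1 c\<^sub>2 \<omega>\<^sub>1 \<omega>\<^sub>2 a q G\<^sub>1 G\<^sub>2 G\<^sub>3 u v y w A H\<^sub>1 H\<^sub>2 H\<^sub>3 u\<^sub>0 v\<^sub>0 y\<^sub>0 w\<^sub>0 k\<^sub>1 k\<^sub>2 k\<^sub>3
    by (fact c)
  \<comment> \<open>The exchanged instance supplies the upper bounds for the reciprocal
    quotients.\<close>
  interpret c2: tail_comparison c\<^sub>1 c\<^sub>2 \<omega>\<^sub>1 \<omega>\<^sub>2 a q H\<^sub>1 H\<^sub>2 H\<^sub>3 u\<^sub>0 v\<^sub>0 y\<^sub>0 w\<^sub>0 A G\<^sub>1 G\<^sub>2 G\<^sub>3 u v y w k\<^sub>1 k\<^sub>2 k\<^sub>3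
    by unfold_locales (rule regular_pair_sym[OF c1.rp1] regular_pair_sym[OF c1.rp2]
      regular_pair_sym[OF c1.rp3] c1.subcritical)+
  note ge1 = c1.s0.ge1
  have *: "\<forall>\<^sub>F r in at_top. x r > 0" if "\<And>r. r \<ge> A \<Longrightarrow> x r \<ge> 1" for x :: "real \<Rightarrow> real"
    using c1.ev_ge_A by eventually_elim (use that less_le_trans zero_less_one in blast)
  show "((\<lambda>r. u r / u\<^sub>0 r) \<longlongrightarrow> 1) at_top" by (intro tendsto_divide_1I c1.u_le c2.u_le * ge1)
  show "((\<lambda>r. v r / v\<^sub>0 r) \<longlongrightarrow> 1) at_top" by (intro tendsto_divide_1I c1.v_le c2.v_le * ge1)
  show "((\<lambda>r. y r / y\<^sub>0 r) \<longlongrightarrow> 1) at_top" by (intro tendsto_divide_1I c1.y_le c2.y_le * ge1)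
  show "((\<lambda>r. w r / w\<^sub>0 r) \<longlongrightarrow> 1) at_top" by (intro tendsto_divide_1I c1.w_le c2.w_le * ge1)
qed

subsection \<open>Radial solutions near the origin and near infinity\<close>

text \<open>Integrating over \<open>[r / 2, r]\<close>, where the weight stays above
  \<open>\<delta> * c r\<close>, cancels the weight and leaves a linear lower bound for
  \<open>b\<close>; the nonnegative term at \<open>r / 2\<close> is dropped.\<close>

lemma growth_at_top:
  fixes b c :: "real \<Rightarrow> real"
  assumes K: "K > 0" "\<delta> > 0"
    and Y: "\<And>r. r \<ge> a \<Longrightarrow> ((\<lambda>r. c r * b r) has_real_derivative Y' r) (at r)"
    and ge: "\<And>r. r \<ge> a \<Longrightarrow> Y' r \<ge> K * c r"
    and b: "\<And>r. r \<ge> a \<Longrightarrow> b r \<ge> 0" and c: "\<And>r. r \<ge> a \<Longrightarrow> c r > 0" and a: "a > 0"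
    and half: "\<And>r s. r \<ge> 2 * a \<Longrightarrow> r / 2 \<le> s \<Longrightarrow> s \<le> r \<Longrightarrow> c s \<ge> \<delta> * c r"
  shows "filterlim b at_top at_top"
proof (rule filterlim_at_top_mono)
  show "filterlim (\<lambda>r. K * \<delta> / 2 * r) at_top at_top"
    using K by (intro filterlim_tendsto_pos_mult_at_top[OF tendsto_const]) (auto simp: filterlim_ident)
  show "\<forall>\<^sub>F r in at_top. K * \<delta> / 2 * r \<le> b r"
    using eventually_ge_at_top[of "2 * a"]
  proof eventually_elim
    case (elim r)
    have "K * \<delta> * c r * (r - r / 2) \<le> 1 * (c r * b r)"
    proof (rule le_mult_of_deriv_le[where A = "r / 2" and X = "\<lambda>s. K * \<delta> * c r * (s - r / 2)"
          and X' = "\<lambda>_. K * \<delta> * c r" and X\<^sub>0 = "\<lambda>r. c r * b r" and X\<^sub>0' = Y'])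
      fix s assume s: "r / 2 \<le> s" "s \<le> r"
      then have "s \<ge> a" using elim by simp
      then show "((\<lambda>r. c r * b r) has_real_derivative Y' s) (at s)" by (rule Y)
      have "K * (\<delta> * c r) \<le> K * c s" using K half[OF elim s] by (intro mult_left_mono) auto
      also have "\<dots> \<le> Y' s" using \<open>s \<ge> a\<close> by (rule ge)
      finally show "K * \<delta> * c r \<le> 1 * Y' s" by (simp add: mult.assoc)
      show "((\<lambda>s. K * \<delta> * c r * (s - r / 2)) has_real_derivative K * \<delta> * c r) (at s)"
        by (auto intro!: derivative_eq_intros)
    qed (use elim a b[of "r / 2"] c[of "r / 2"] in auto)
    then have "c r * (K * \<delta> / 2 * r) \<le> c r * b r" by (simp add: field_simps)
    then show ?case using c[of r] elim a by simp
  qed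
qed

text \<open>Integration starts at some \<open>e > 0\<close>, and then \<open>e\<close> tends to
  \<open>0\<close>; of the behaviour at the origin only the limit enters.\<close>

lemma le_mult_of_deriv_le_0:
  fixes X :: "real \<Rightarrow> real"
  assumes r: "r > 0" and D: "D \<ge> 0"
    and X: "\<And>s. 0 < s \<Longrightarrow> s \<le> r \<Longrightarrow> (X has_real_derivative X' s) (at s)"
    and le: "\<And>s. 0 < s \<Longrightarrow> s \<le> r \<Longrightarrow> X' s \<le> D"
    and lim: "(X \<longlongrightarrow> 0) (at_right 0)"
  shows "X r \<le> D * r"
proof -
  have "\<forall>\<^sub>F e in at_right 0. X r - D * r \<le> X e"
    using eventually_at_right_real[OF r]
  proof eventually_elim
    case (elim e)
    then have e: "0 < e" "e < r" by auto
    have "X r - X e \<le> D * (r - e)"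
      by (rule le_mult_of_deriv_le[of e r "\<lambda>s. X s - X e" X' "\<lambda>s. s - e" "\<lambda>_. 1"])
        (use e le in \<open>auto intro!: derivative_eq_intros X\<close>)
    moreover have "D * e \<ge> 0" using D e by simp
    ultimately show ?case by (simp add: algebra_simps)
  qed
  with lim have "X r - D * r \<le> 0" by (intro tendsto_lowerbound) auto
  then show ?thesis by simp
qed

section \<open>The one-variable system: positivity, subcritical exponents and growth\<close>

text \<open>Here \<open>m = n - 1\<close>, \<open>q = p - 1\<close>, and \<open>y\<close>,
  \<open>w\<close> are the derivatives, already known to be nonnegative, so that the flux is a plain
  power. The last three assumptions record what regularity at the origin provides.\<close>

locale radial_system =
  fixes m :: nat and q \<alpha> :: real and f\<^sub>1 f\<^sub>2 G\<^sub>1 G\<^sub>2 G\<^sub>3 u v y w :: "real \<Rightarrow> real"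
  assumes m: "m \<ge> 1" and q: "q > 0" and \<alpha>: "\<alpha> \<ge> 0"
    and f_pos: "r > 0 \<Longrightarrow> f\<^sub>1 r > 0" "r > 0 \<Longrightarrow> f\<^sub>2 r > 0"
    and f_mono: "0 < s \<Longrightarrow> s \<le> r \<Longrightarrow> f\<^sub>1 s \<le> f\<^sub>1 r" "0 < s \<Longrightarrow> s \<le> r \<Longrightarrow> f\<^sub>2 s \<le> f\<^sub>2 r"
    and G_pos: "t > 0 \<Longrightarrow> G\<^sub>1 t > 0" "t > 0 \<Longrightarrow> G\<^sub>2 t > 0" "t > 0 \<Longrightarrow> G\<^sub>3 t > 0"
    and G_mono: "0 < s \<Longrightarrow> s \<le> t \<Longrightarrow> G\<^sub>1 s \<le> G\<^sub>1 t" "0 < s \<Longrightarrow> s \<le> t \<Longrightarrow> G\<^sub>2 s \<le> G\<^sub>2 t"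
      "0 < s \<Longrightarrow> s \<le> t \<Longrightarrow> G\<^sub>3 s \<le> G\<^sub>3 t"
    and u_pos: "r > 0 \<Longrightarrow> u r > 0" and v_pos: "r > 0 \<Longrightarrow> v r > 0"
    and y_nonneg: "r > 0 \<Longrightarrow> y r \<ge> 0" and w_nonneg: "r > 0 \<Longrightarrow> w r \<ge> 0"
    and deriv_u: "r > 0 \<Longrightarrow> (u has_real_derivative y r) (at r)"
    and deriv_v: "r > 0 \<Longrightarrow> (v has_real_derivative w r) (at r)"
    and ode_u: "r > 0 \<Longrightarrow> ((\<lambda>r. r ^ m * y r powr q) has_real_derivative
      r ^ m * (f\<^sub>1 r * G\<^sub>1 (v r) * rpow (y r) \<alpha>)) (at r)"
    and ode_v: "r > 0 \<Longrightarrow> ((\<lambda>r. r ^ m * w r powr q) has_real_derivative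
      r ^ m * (f\<^sub>2 r * G\<^sub>2 (v r) * G\<^sub>3 (y r))) (at r)"
    and y_bdd: "\<exists>Y. \<forall>\<^sub>F r in at_right 0. y r \<le> Y"
    and flux_u: "((\<lambda>r. r ^ m * y r powr q) \<longlongrightarrow> 0) (at_right 0)"
    and flux_v: "((\<lambda>r. r ^ m * w r powr q) \<longlongrightarrow> 0) (at_right 0)"
begin

lemma v_mono: assumes "0 < s" "s \<le> r" shows "v s \<le> v r"
proof (rule DERIV_nonneg_imp_nondecreasing[OF assms(2)])
  fix t assume "s \<le> t"
  with assms have "t > 0" by simp
  then show "\<exists>z. (v has_real_derivative z) (at t) \<and> 0 \<le> z" using deriv_v w_nonneg by blast
qed

lemma z_mono: assumes "0 < s" "s \<le> r" shows "s ^ m * y s powr q \<le> r ^ m * y r powr q"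
proof (rule DERIV_nonneg_imp_nondecreasing[OF assms(2)])
  fix t assume "s \<le> t"
  with assms have t: "t > 0" by simp
  have "0 \<le> t ^ m * (f\<^sub>1 t * G\<^sub>1 (v t) * rpow (y t) \<alpha>)"
    using t f_pos(1)[OF t] G_pos(1)[OF v_pos[OF t]] by (auto simp: rpow_def)
  with ode_u[OF t] show "\<exists>z. ((\<lambda>r. r ^ m * y r powr q) has_real_derivative z) (at t) \<and> 0 \<le> z" by blast
qed

text \<open>The weighted flux never decreases, so a derivative that is positive once stays positive,
  even if it vanishes on an initial interval.\<close>

lemma y_pos_mono: assumes "0 < s" "s \<le> r" "y s > 0" shows "y r > 0"
proof (rule ccontr)
  assume "\<not> y r > 0"
  with assms y_nonneg[of r] have "y r = 0" by simp
  with z_mono[OF assms(1,2)] have "s ^ m * y s powr q \<le> 0" by simp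
  moreover have "s ^ m * y s powr q > 0" using assms by simp
  ultimately show False by simp
qed

text \<open>If \<open>\<alpha> \<ge> q\<close>, the logarithmic derivative
  \<open>f\<^sub>1 t * G\<^sub>1 (v t) * y t powr (\<alpha> - q)\<close> of the weighted flux is
  bounded near \<open>0\<close>, because \<open>y\<close> is. The flux would then stay away from
  zero, against \<open>flux_u\<close>.\<close>

lemma \<alpha>_less:
  assumes y: "\<And>r. r > 0 \<Longrightarrow> y r > 0" shows "\<alpha> < q"
proof (rule ccontr)
  assume "\<not> \<alpha> < q"
  then have \<alpha>q: "\<alpha> - q \<ge> 0" by simp
  obtain Y where Y: "\<forall>\<^sub>F r in at_right 0. y r \<le> Y" using y_bdd by blast
  then obtain R where R: "R > 0" "\<And>r. 0 < r \<Longrightarrow> r < R \<Longrightarrow> y r \<le> Y"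
    unfolding eventually_at_right_field by auto
  \<comment> \<open>Half of \<open>R\<close>, so that the bound on \<open>y\<close> holds up to and
    including \<open>s\<close>.\<close>
  define s where "s = R / 2"
  have s: "s > 0" "s < R" using R by (auto simp: s_def)
  define z where "z = (\<lambda>r. r ^ m * y r powr q)"
  have z: "r > 0 \<Longrightarrow> z r > 0" for r using y[of r] by (simp add: z_def)
  define D where "D = f\<^sub>1 s * G\<^sub>1 (v s) * Y powr (\<alpha> - q)"
  have D: "D \<ge> 0" using f_pos(1)[OF s(1)] G_pos(1)[OF v_pos[OF s(1)]] by (simp add: D_def)
  have lnz: "ln (z s) - ln (z r) \<le> D * (s - r)" if r: "0 < r" "r \<le> s" for r
  proof (rule le_mult_of_deriv_le[OF r(2), of "\<lambda>t. ln (z t) - ln (z r)"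
        "\<lambda>t. f\<^sub>1 t * G\<^sub>1 (v t) * y t powr (\<alpha> - q)" "\<lambda>t. t - r" "\<lambda>_. 1"])
    fix t assume t: "r \<le> t" "t \<le> s"
    then have t0: "t > 0" using r by simp
    have "((\<lambda>t. ln (z t)) has_real_derivative 1 / z t * (t ^ m * (f\<^sub>1 t * G\<^sub>1 (v t) * rpow (y t) \<alpha>))) (at t)"
      using ode_u[OF t0] z[OF t0] unfolding z_def by (rule DERIV_ln_divide[THEN DERIV_chain2, rotated])
    then have "((\<lambda>t. ln (z t) - ln (z r)) has_real_derivative
        1 / z t * (t ^ m * (f\<^sub>1 t * G\<^sub>1 (v t) * rpow (y t) \<alpha>)) - 0) (at t)"
      by (intro DERIV_diff DERIV_const)
    also have "1 / z t * (t ^ m * (f\<^sub>1 t * G\<^sub>1 (v t) * rpow (y t) \<alpha>)) - 0 =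
        f\<^sub>1 t * G\<^sub>1 (v t) * y t powr (\<alpha> - q)"
      using y[OF t0] t0 by (auto simp: z_def rpow_def powr_diff)
    finally show "((\<lambda>t. ln (z t) - ln (z r)) has_real_derivative f\<^sub>1 t * G\<^sub>1 (v t) * y t powr (\<alpha> - q)) (at t)" .
    have "f\<^sub>1 t * G\<^sub>1 (v t) * y t powr (\<alpha> - q) \<le> D"
      unfolding D_def using t0 t s \<alpha>q y[OF t0] R(2)[OF t0] v_pos[OF t0] f_pos(1)[OF s(1)] G_pos(1)[OF v_pos[OF s(1)]]
        G_pos(1)[OF v_pos[OF t0]]
      by (intro mult_mono f_mono G_mono v_mono powr_mono2) auto
    then show "f\<^sub>1 t * G\<^sub>1 (v t) * y t powr (\<alpha> - q) \<le> D * 1" by simp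
  qed (auto intro!: derivative_eq_intros)
  have lb: "z s * exp (- (D * s)) \<le> z r" if r: "0 < r" "r < s" for r
  proof -
    have "D * r \<ge> 0" using D r by simp
    then have "ln (z s) - D * s \<le> ln (z r)" using lnz[of r] r by (simp add: algebra_simps)
    then have "exp (ln (z s) - D * s) \<le> exp (ln (z r))" by simp
    then show ?thesis using z[of r] z[of s] r s by (simp add: exp_diff exp_minus divide_inverse)
  qed
  have "\<forall>\<^sub>F r in at_right 0. z s * exp (- (D * s)) \<le> z r"
    using eventually_at_right_real[OF s(1)] by eventually_elim (use lb in auto)
  with flux_u have "z s * exp (- (D * s)) \<le> 0"
    unfolding z_def by (intro tendsto_lowerbound) auto
  then show False using z[OF s(1)] by (simp add: mult_le_0_iff)
qed

text \<open>Chosen so that \<open>q * (\<tau> - 1) = - \<alpha>\<close>, which makes the powers of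
  \<open>y\<close> cancel.\<close>

definition \<tau> :: real where "\<tau> = (q - \<alpha>) / q"

text \<open>
  Dividing by \<open>|u'|\<^sup>\<alpha>\<close>: the power \<open>z\<^sup>\<tau>\<close> of \<open>z = r\<^sup>m u'\<^sup>q\<close> has a derivative not involving \<open>u'\<close>.
\<close>

lemma ode_X:
  assumes r: "r > 0" and y: "y r > 0"
  shows "((\<lambda>r. (r ^ m) powr \<tau> * y r powr (q - \<alpha>)) has_real_derivative
    \<tau> * (r ^ m) powr \<tau> * f\<^sub>1 r * G\<^sub>1 (v r)) (at r)"
proof -
  let ?z = "\<lambda>r. r ^ m * y r powr q"
  have qt: "q * \<tau> = q - \<alpha>" using q by (simp add: \<tau>_def)
  have "((\<lambda>r. ?z r powr \<tau>) has_real_derivative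
      \<tau> * ?z r powr (\<tau> - 1) * (r ^ m * (f\<^sub>1 r * G\<^sub>1 (v r) * rpow (y r) \<alpha>))) (at r)"
    using ode_u[OF r] r y by (intro has_real_derivative_powr[THEN DERIV_chain2]) auto
  also have "\<tau> * ?z r powr (\<tau> - 1) * (r ^ m * (f\<^sub>1 r * G\<^sub>1 (v r) * rpow (y r) \<alpha>))
      = \<tau> * f\<^sub>1 r * G\<^sub>1 (v r) * ((r ^ m) powr (\<tau> - 1) * r ^ m) * (y r powr (q * (\<tau> - 1)) * y r powr \<alpha>)"
    using r y by (auto simp: powr_mult powr_powr rpow_def mult_ac)
  also have "(r ^ m) powr (\<tau> - 1) * r ^ m = (r ^ m) powr \<tau>"
    using r by (simp add: powr_diff)
  also have "y r powr (q * (\<tau> - 1)) * y r powr \<alpha> = 1"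
    using y qt by (simp add: powr_add[symmetric] right_diff_distrib)
  finally have "((\<lambda>r. ?z r powr \<tau>) has_real_derivative \<tau> * (r ^ m) powr \<tau> * f\<^sub>1 r * G\<^sub>1 (v r)) (at r)"
    by (simp add: mult_ac)
  then show ?thesis
    by (rule has_field_derivative_transform_within_open[of _ _ _ "{0<..}"])
      (use r in \<open>auto simp: powr_mult powr_powr qt\<close>)
qed

text \<open>
  If all data vanish at the origin, integrating twice gives \<open>v\<^sup>q \<le> C r v\<^sup>\<theta>\<close> with
  \<open>\<theta> = k\<^sub>2 + k\<^sub>1 k\<^sub>3 / (q - \<alpha>)\<close>, which is impossible for small \<open>v\<close> unless \<open>\<theta> < q\<close>.
\<close>

lemma subcritical:
  assumes y: "\<And>r. r > 0 \<Longrightarrow> y r > 0" and \<alpha>q: "\<alpha> < q"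
    and v0: "(v \<longlongrightarrow> 0) (at_right 0)" and k: "k\<^sub>1 \<ge> 0" "k\<^sub>2 \<ge> 0" "k\<^sub>3 \<ge> 0"
    and G1: "\<And>t. 0 < t \<Longrightarrow> t \<le> 1 \<Longrightarrow> G\<^sub>1 t \<le> C\<^sub>1 * t powr k\<^sub>1"
    and G2: "\<And>t. 0 < t \<Longrightarrow> t \<le> 1 \<Longrightarrow> G\<^sub>2 t \<le> C\<^sub>2 * t powr k\<^sub>2"
    and G3: "\<And>t. 0 < t \<Longrightarrow> t \<le> 1 \<Longrightarrow> G\<^sub>3 t \<le> C\<^sub>3 * t powr k\<^sub>3"
  shows "k\<^sub>2 + k\<^sub>1 * k\<^sub>3 / (q - \<alpha>) < q"
proof (rule ccontr)
  define \<theta> where "\<theta> = k\<^sub>2 + k\<^sub>1 * k\<^sub>3 / (q - \<alpha>)"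
  define a where "a = q - \<alpha>"
  have a: "a > 0" using \<alpha>q by (simp add: a_def)
  assume "\<not> k\<^sub>2 + k\<^sub>1 * k\<^sub>3 / (q - \<alpha>) < q"
  then have \<theta>: "q \<le> \<theta>" by (simp add: \<theta>_def)
  have C: "C\<^sub>1 > 0" "C\<^sub>2 > 0" "C\<^sub>3 > 0" using G1[of 1] G2[of 1] G3[of 1] G_pos[of 1] by simp_all
  have f: "f\<^sub>1 1 > 0" "f\<^sub>2 1 > 0" using f_pos[of 1] by auto
  have \<tau>: "0 \<le> \<tau>" "\<tau> \<le> 1" using \<alpha> \<alpha>q q by (auto simp: \<tau>_def)
  define K where "K = f\<^sub>1 1 * C\<^sub>1"
  define K2 where "K2 = f\<^sub>2 1 * C\<^sub>2 * C\<^sub>3"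
  have K: "K > 0" "K2 > 0" using C f by (auto simp: K_def K2_def)
  \<comment> \<open>\<open>r\<close> is so small that \<open>v r\<close> lies in the range of the
    power bounds and that the factor \<open>r\<close> gained by integration beats the constants
    \<open>K\<close> and \<open>K2\<close>.\<close>
  have "\<forall>\<^sub>F r in at_right 0. r \<in> {0<..<min 1 (min (1 / K) (1 / K2))} \<and> v r < 1"
    using K by (intro eventually_conj eventually_at_right_real order_tendstoD[OF v0]) auto
  then obtain r where "r \<in> {0<..<min 1 (min (1 / K) (1 / K2))} \<and> v r < 1"
    using eventually_happens[of _ "at_right (0::real)"] by (auto simp: trivial_limit_at_right_real)
  then have r: "r > 0" "r < 1" "K * r < 1" "K2 * r < 1" and vr: "v r < 1"
    using K by (auto simp: field_simps)
  have vr0: "v r > 0" using r v_pos by simp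
  have vs: "0 < v s" "v s \<le> v r" "v s \<le> 1" "s \<le> 1" if "0 < s" "s \<le> r" for s
    using v_pos v_mono[OF that] vr that r by auto
  \<comment> \<open>First integration, from the origin to \<open>s\<close>: \<open>v\<close> and the
    weight are replaced by their values at \<open>s\<close>, \<open>f\<^sub>1\<close> by its value
    at \<open>1\<close>, and \<tau> by \<open>1\<close>.\<close>
  have yb: "y s powr a \<le> K * v s powr k\<^sub>1 * s" if s: "0 < s" "s \<le> r" for s
  proof -
    have "(s ^ m) powr \<tau> * y s powr (q - \<alpha>) \<le> ((s ^ m) powr \<tau> * (K * v s powr k\<^sub>1)) * s"
    proof (rule le_mult_of_deriv_le_0)
      fix t assume t: "0 < t" "t \<le> s"
      then have tr: "t \<le> r" using s by simp
      show "((\<lambda>r. (r ^ m) powr \<tau> * y r powr (q - \<alpha>)) has_real_derivative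
          \<tau> * (t ^ m) powr \<tau> * f\<^sub>1 t * G\<^sub>1 (v t)) (at t)"
        by (intro ode_X y t)
      have "G\<^sub>1 (v t) \<le> G\<^sub>1 (v s)" using v_mono[OF t] vs[of t] t tr by (intro G_mono) auto
      also have "\<dots> \<le> C\<^sub>1 * v s powr k\<^sub>1" using vs[OF s] by (intro G1) auto
      finally have "\<tau> * (t ^ m) powr \<tau> * f\<^sub>1 t * G\<^sub>1 (v t) \<le> 1 * (s ^ m) powr \<tau> * f\<^sub>1 1 * (C\<^sub>1 * v s powr k\<^sub>1)"
        using t \<tau> f_pos[of t] f vs[of t] tr G_pos(1)[of "v t"]
        by (intro mult_mono powr_mono2 power_mono f_mono) auto
      then show "\<tau> * (t ^ m) powr \<tau> * f\<^sub>1 t * G\<^sub>1 (v t) \<le> (s ^ m) powr \<tau> * (K * v s powr k\<^sub>1)"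
        by (simp add: K_def mult_ac)
    next
      have "((\<lambda>r. (r ^ m * y r powr q) powr \<tau>) \<longlongrightarrow> 0) (at_right 0)"
        using \<alpha>q q by (intro tendsto_zero_powrI[OF flux_u tendsto_const])
          (auto simp: \<tau>_def eventually_at_filter)
      then show "((\<lambda>r. (r ^ m) powr \<tau> * y r powr (q - \<alpha>)) \<longlongrightarrow> 0) (at_right 0)"
        by (rule Lim_transform_eventually)
          (use q in \<open>auto simp: powr_mult powr_powr eventually_at_filter \<tau>_def\<close>)
    qed (use s K in auto)
    then have "(s ^ m) powr \<tau> * y s powr a \<le> (s ^ m) powr \<tau> * (K * v s powr k\<^sub>1 * s)"
      by (simp add: a_def mult_ac)
    then show ?thesis using s by simp
  qed
  define B where "B = (K * v r powr k\<^sub>1 * r) powr (1 / a)"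
  have yB: "y s \<le> B" if s: "0 < s" "s \<le> r" for s
  proof -
    have "y s powr a \<le> K * v s powr k\<^sub>1 * s" by (rule yb[OF s])
    also have "\<dots> \<le> K * v r powr k\<^sub>1 * r"
      using vs[OF s] s K k by (intro mult_mono powr_mono2) auto
    finally have "(y s powr a) powr (1 / a) \<le> B"
      unfolding B_def using a by (intro powr_mono2) auto
    then show ?thesis using a y[OF s(1)] by (simp add: powr_powr)
  qed
  have vk: "v r powr k\<^sub>1 \<le> 1" "v r powr k\<^sub>1 > 0" using vr vr0 k by (auto intro: powr_le1)
  have Kr: "K * v r powr k\<^sub>1 * r \<le> v r powr k\<^sub>1"
  proof -
    have "(K * r) * v r powr k\<^sub>1 \<le> 1 * v r powr k\<^sub>1" using r vk by (intro mult_right_mono) auto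
    then show ?thesis by (simp add: mult_ac)
  qed
  \<comment> \<open>\<open>B \<le> 1\<close> brings \<open>y\<close> into the range where the power
    bound for \<open>G\<^sub>3\<close> applies.\<close>
  have B: "B > 0" "B \<le> 1"
    using order_trans[OF Kr vk(1)] vk K r vr0 a by (auto simp: B_def intro!: powr_le1)
  have "B powr k\<^sub>3 = (K * v r powr k\<^sub>1 * r) powr (k\<^sub>3 / a)" by (simp add: B_def powr_powr)
  also have "\<dots> \<le> (v r powr k\<^sub>1) powr (k\<^sub>3 / a)"
    using Kr K r vk k a by (intro powr_mono2) auto
  also have "\<dots> = v r powr (k\<^sub>1 * k\<^sub>3 / a)" by (simp add: powr_powr)
  finally have Bk: "B powr k\<^sub>3 \<le> v r powr (k\<^sub>1 * k\<^sub>3 / a)" .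
  define E where "E = f\<^sub>2 1 * (C\<^sub>2 * v r powr k\<^sub>2) * (C\<^sub>3 * B powr k\<^sub>3)"
  have E0: "E > 0" using f C vr0 B by (simp add: E_def)
  have "E \<le> f\<^sub>2 1 * (C\<^sub>2 * v r powr k\<^sub>2) * (C\<^sub>3 * v r powr (k\<^sub>1 * k\<^sub>3 / a))"
    unfolding E_def using f C Bk by (intro mult_left_mono) auto
  also have "\<dots> = K2 * v r powr \<theta>" by (simp add: K2_def \<theta>_def a_def powr_add mult_ac)
  \<comment> \<open>Here the negated claim \<open>q \<le> \<theta>\<close> enters: as
    \<open>v r < 1\<close>, the larger exponent gives the smaller power.\<close>
  also have "\<dots> \<le> K2 * v r powr q"
    using \<theta> vr vr0 K by (intro mult_left_mono powr_mono') auto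
  finally have E: "E \<le> K2 * v r powr q" .
  have wb: "w s \<le> (E * r) powr (1 / q)" if s: "0 < s" "s \<le> r" for s
  proof -
    have "s ^ m * w s powr q \<le> (s ^ m * E) * s"
    proof (rule le_mult_of_deriv_le_0[OF s(1) _ ode_v _ flux_v])
      fix t assume t: "0 < t" "t \<le> s"
      then have tr: "t \<le> r" using s by simp
      have "G\<^sub>2 (v t) \<le> G\<^sub>2 (v r)" using v_mono[OF t(1) tr] vs[OF t(1) tr] by (intro G_mono) auto
      also have "\<dots> \<le> C\<^sub>2 * v r powr k\<^sub>2" using vr vr0 by (intro G2) auto
      finally have 2: "G\<^sub>2 (v t) \<le> C\<^sub>2 * v r powr k\<^sub>2" .
      have "G\<^sub>3 (y t) \<le> G\<^sub>3 B" using yB[OF t(1) tr] y[OF t(1)] by (intro G_mono) auto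
      also have "\<dots> \<le> C\<^sub>3 * B powr k\<^sub>3" using B by (intro G3) auto
      finally have 3: "G\<^sub>3 (y t) \<le> C\<^sub>3 * B powr k\<^sub>3" .
      have "f\<^sub>2 t * G\<^sub>2 (v t) * G\<^sub>3 (y t) \<le> E"
        unfolding E_def using 2 3 t tr r f_pos[OF t(1)] f C vs[OF t(1) tr] y[OF t(1)]
          G_pos(2)[of "v t"] G_pos(3)[of "y t"]
        by (intro mult_mono f_mono) auto
      then show "t ^ m * (f\<^sub>2 t * G\<^sub>2 (v t) * G\<^sub>3 (y t)) \<le> s ^ m * E"
        using t E0 f_pos[OF t(1)] vs[OF t(1) tr] y[OF t(1)] G_pos(2)[of "v t"] G_pos(3)[of "y t"]
        by (intro mult_mono power_mono) auto
    qed (use s E0 in auto)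
    then have "s ^ m * w s powr q \<le> s ^ m * (E * s)" by (simp add: mult_ac)
    then have "w s powr q \<le> E * s" using s by simp
    also have "\<dots> \<le> E * r" using s E0 by simp
    finally have "(w s powr q) powr (1 / q) \<le> (E * r) powr (1 / q)"
      using q by (intro powr_mono2) auto
    then show ?thesis using q w_nonneg[OF s(1)] by (simp add: powr_powr)
  qed
  \<comment> \<open>The last integration, from \<open>w\<close> to \<open>v\<close>. It leads to
    \<open>v r powr q \<le> K2 * r * v r powr q\<close>, which contradicts
    \<open>K2 * r < 1\<close>.\<close>
  have "v r \<le> (E * r) powr (1 / q) * r"
    by (rule le_mult_of_deriv_le_0[OF r(1) _ deriv_v wb v0]) auto
  also have "\<dots> \<le> (E * r) powr (1 / q)" using r by (intro mult_left_le) auto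
  finally have "v r powr q \<le> ((E * r) powr (1 / q)) powr q"
    using q vr0 by (intro powr_mono2) auto
  also have "\<dots> = E * r" using q E0 r by (simp add: powr_powr)
  also have "\<dots> \<le> (K2 * v r powr q) * r" using E r by (intro mult_right_mono) auto
  also have "\<dots> = (K2 * r) * v r powr q" by (simp add: mult_ac)
  also have "\<dots> < 1 * v r powr q" using r vr0 by (intro mult_strict_right_mono) auto
  finally show False by simp
qed

text \<open>The blow-up is obtained in this order: \<open>y\<close>, as its source is bounded below;
  \<open>w\<close>, once \<open>y \<ge> 1\<close> bounds \<open>G\<^sub>3\<close> from below; then
  \<open>u\<close> and \<open>v\<close> by integration. Allowing all large \<open>A\<close> lets two
  solutions share a starting point.\<close>

lemma eventually_tail_solution:
  assumes a0: "a\<^sub>0 > 0" "y a\<^sub>0 > 0" and \<alpha>q: "\<alpha> < q"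
  shows "\<forall>\<^sub>F A in at_top. tail_solution (\<lambda>r. (r ^ m) powr \<tau>) (\<lambda>r. r ^ m)
    (\<lambda>r. \<tau> * (r ^ m) powr \<tau> * f\<^sub>1 r) (\<lambda>r. r ^ m * f\<^sub>2 r) (q - \<alpha>) q G\<^sub>1 G\<^sub>2 G\<^sub>3 u v y w A"
proof -
  let ?c1 = "\<lambda>r::real. (r ^ m) powr \<tau>"
  let ?\<omega>1 = "\<lambda>r. \<tau> * (r ^ m) powr \<tau> * f\<^sub>1 r"
  have \<tau>: "\<tau> > 0" using \<alpha>q q by (simp add: \<tau>_def)
  have half: "s ^ m \<ge> (1 / 2) ^ m * r ^ m" if "r \<ge> 0" "r / 2 \<le> s" for r s :: real
    using that power_mono[of "r / 2" s m] by (simp add: power_divide)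
  have ypos: "y r > 0" if "r \<ge> a\<^sub>0" for r using y_pos_mono[OF a0(1) that a0(2)] .
  have X: "((\<lambda>r. ?c1 r * y r powr (q - \<alpha>)) has_real_derivative ?\<omega>1 r * G\<^sub>1 (v r)) (at r)" if "r \<ge> a\<^sub>0" for r
    using ode_X[of r] ypos[OF that] a0 that by simp
  have Z: "((\<lambda>r. r ^ m * w r powr q) has_real_derivative (r ^ m * f\<^sub>2 r) * (G\<^sub>2 (v r) * G\<^sub>3 (y r))) (at r)"
    if "r > 0" for r
    using ode_v[OF that] by (simp add: mult_ac)
  have yq: "filterlim (\<lambda>r. y r powr (q - \<alpha>)) at_top at_top"
  proof (rule growth_at_top[OF _ _ X])
    show "\<tau> * (f\<^sub>1 a\<^sub>0 * G\<^sub>1 (v a\<^sub>0)) > 0" using \<tau> f_pos a0 G_pos v_pos by simp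
    show "((1::real) / 2) powr (m * \<tau>) > 0" by simp
    show "\<tau> * (f\<^sub>1 a\<^sub>0 * G\<^sub>1 (v a\<^sub>0)) * ?c1 r \<le> ?\<omega>1 r * G\<^sub>1 (v r)" if "r \<ge> a\<^sub>0" for r
    proof -
      have "f\<^sub>1 a\<^sub>0 * G\<^sub>1 (v a\<^sub>0) \<le> f\<^sub>1 r * G\<^sub>1 (v r)"
        using a0 that f_pos[of r] f_pos[OF a0(1)] v_pos[OF a0(1)] G_pos(1)[of "v a\<^sub>0"]
        by (intro mult_mono f_mono G_mono v_mono) auto
      then have "(\<tau> * ?c1 r) * (f\<^sub>1 a\<^sub>0 * G\<^sub>1 (v a\<^sub>0)) \<le> (\<tau> * ?c1 r) * (f\<^sub>1 r * G\<^sub>1 (v r))"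
        using \<tau> by (intro mult_left_mono) auto
      then show ?thesis by (simp add: mult_ac)
    qed
    show "(1 / 2) powr (m * \<tau>) * ?c1 r \<le> ?c1 s" if "r \<ge> 2 * a\<^sub>0" "r / 2 \<le> s" for r s
    proof -
      have "(1 / 2) powr (m * \<tau>) * ?c1 r = ((1 / 2) ^ m * r ^ m) powr \<tau>"
        by (simp add: powr_mult powr_powr powr_realpow[symmetric])
      also have "\<dots> \<le> ?c1 s" using half[of r s] that a0 \<tau> by (intro powr_mono2) auto
      finally show ?thesis .
    qed
  qed (use a0 in auto)
  have y: "filterlim y at_top at_top"
    using \<alpha>q by (intro filterlim_powr_cancel_at_top[OF yq])
      (simp, rule eventually_mono[OF eventually_gt_at_top[of 0] y_nonneg])
  then have "\<forall>\<^sub>F r in at_top. y r \<ge> 1" by (simp add: filterlim_at_top)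
  then obtain b where b: "\<And>r. r \<ge> b \<Longrightarrow> y r \<ge> 1" by (auto simp: eventually_at_top_linorder)
  define b\<^sub>0 where "b\<^sub>0 = max 1 b"
  have b0: "b\<^sub>0 > 0" "r \<ge> b\<^sub>0 \<Longrightarrow> y r \<ge> 1" for r using b by (auto simp: b\<^sub>0_def)
  have wq: "filterlim (\<lambda>r. w r powr q) at_top at_top"
  proof (rule growth_at_top[where a = b\<^sub>0, OF _ _ Z])
    show "f\<^sub>2 b\<^sub>0 * (G\<^sub>2 (v b\<^sub>0) * G\<^sub>3 1) > 0" using f_pos b0 G_pos v_pos by simp
    show "((1::real) / 2) ^ m > 0" by simp
    show "f\<^sub>2 b\<^sub>0 * (G\<^sub>2 (v b\<^sub>0) * G\<^sub>3 1) * r ^ m \<le> (r ^ m * f\<^sub>2 r) * (G\<^sub>2 (v r) * G\<^sub>3 (y r))"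
      if "r \<ge> b\<^sub>0" for r
    proof -
      have "f\<^sub>2 b\<^sub>0 * (G\<^sub>2 (v b\<^sub>0) * G\<^sub>3 1) \<le> f\<^sub>2 r * (G\<^sub>2 (v r) * G\<^sub>3 (y r))"
        using b0 that f_pos[of r] f_pos[OF b0(1)] v_pos[OF b0(1)] v_pos[of r]
          G_pos(2)[of "v b\<^sub>0"] G_pos(2)[of "v r"] G_pos(3)[of 1]
        by (intro mult_mono f_mono G_mono v_mono) auto
      then have "r ^ m * (f\<^sub>2 b\<^sub>0 * (G\<^sub>2 (v b\<^sub>0) * G\<^sub>3 1)) \<le> r ^ m * (f\<^sub>2 r * (G\<^sub>2 (v r) * G\<^sub>3 (y r)))"
        using that b0 by (intro mult_left_mono) auto
      then show ?thesis by (simp add: mult_ac)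
    qed
  qed (use b0 half in auto)
  have w: "filterlim w at_top at_top"
    by (rule filterlim_powr_cancel_at_top[OF wq q])
      (rule eventually_mono[OF eventually_gt_at_top[of 0] w_nonneg])
  \<comment> \<open>The growth lemma with constant weight \<open>1\<close>.\<close>
  have int: "filterlim x at_top at_top"
    if lim: "filterlim x' at_top at_top" and x: "\<And>r. r > 0 \<Longrightarrow> (x has_real_derivative x' r) (at r)"
      and pos: "\<And>r. r > 0 \<Longrightarrow> x r > 0" for x x' :: "real \<Rightarrow> real"
  proof -
    have "\<forall>\<^sub>F r in at_top. 1 \<le> x' r" using lim by (simp add: filterlim_at_top)
    then obtain d where d: "\<And>r. r \<ge> d \<Longrightarrow> x' r \<ge> 1" by (auto simp: eventually_at_top_linorder)
    show ?thesis
      by (rule growth_at_top[of 1 1 "max 1 d" "\<lambda>_. 1" x x'])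
        (use d x pos in \<open>auto intro: less_imp_le\<close>)
  qed
  have u: "filterlim u at_top at_top" by (rule int[OF y deriv_u u_pos])
  have v: "filterlim v at_top at_top" by (rule int[OF w deriv_v v_pos])
  have limX: "filterlim (\<lambda>r. ?c1 r * y r powr (q - \<alpha>)) at_top at_top"
  proof (rule filterlim_at_top_mono[OF yq])
    show "\<forall>\<^sub>F r in at_top. y r powr (q - \<alpha>) \<le> ?c1 r * y r powr (q - \<alpha>)"
      using eventually_ge_at_top[of 1]
    proof eventually_elim
      case (elim r)
      then have "1 * y r powr (q - \<alpha>) \<le> ?c1 r * y r powr (q - \<alpha>)"
        using \<tau> by (intro mult_right_mono ge_one_powr_ge_zero) auto
      then show ?case by simp
    qed
  qed
  have limZ: "filterlim (\<lambda>r. r ^ m * w r powr q) at_top at_top"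
  proof (rule filterlim_at_top_mono[OF wq])
    show "\<forall>\<^sub>F r in at_top. w r powr q \<le> r ^ m * w r powr q"
      using eventually_ge_at_top[of 1]
    proof eventually_elim
      case (elim r)
      then have "1 * w r powr q \<le> r ^ m * w r powr q" by (intro mult_right_mono) auto
      then show ?case by simp
    qed
  qed
  have "\<forall>\<^sub>F r in at_top. (1 \<le> u r \<and> 1 \<le> v r) \<and> (1 \<le> y r \<and> 1 \<le> w r)"
    using u v y w by (auto simp: filterlim_at_top intro!: eventually_conj)
  then obtain A\<^sub>1 where A1: "\<And>r. r \<ge> A\<^sub>1 \<Longrightarrow> (1 \<le> u r \<and> 1 \<le> v r) \<and> (1 \<le> y r \<and> 1 \<le> w r)"
    unfolding eventually_at_top_linorder by blast
  show ?thesis using eventually_ge_at_top[of "max a\<^sub>0 A\<^sub>1"]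
  proof eventually_elim
    case (elim A)
    have r: "r > 0" "r \<ge> a\<^sub>0" "r \<ge> A\<^sub>1" if "r \<ge> A" for r using that elim a0 by auto
    show ?case
    proof
      fix r assume "r \<ge> A"
      note r = r[OF this]
      show "?c1 r > 0" "r ^ m > 0" "?\<omega>1 r \<ge> 0" "r ^ m * f\<^sub>2 r \<ge> 0"
        using r \<tau> f_pos[OF r(1)] by auto
      show "(u has_real_derivative y r) (at r)" "(v has_real_derivative w r) (at r)"
        by (fact deriv_u[OF r(1)] deriv_v[OF r(1)])+
      show "((\<lambda>r. ?c1 r * y r powr (q - \<alpha>)) has_real_derivative ?\<omega>1 r * G\<^sub>1 (v r)) (at r)"
        by (rule X[OF r(2)])
      show "((\<lambda>r. r ^ m * w r powr q) has_real_derivative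
          r ^ m * f\<^sub>2 r * (G\<^sub>2 (v r) * G\<^sub>3 (y r))) (at r)" by (rule Z[OF r(1)])
      show "u r \<ge> 1" "v r \<ge> 1" "y r \<ge> 1" "w r \<ge> 1" using A1[OF r(3)] by auto
    qed (use \<alpha>q q u v y limX limZ in auto)
  qed
qed

end

section \<open>From the equations in space to the one-variable system\<close>

text \<open>The flux is differentiable, hence continuous, at the origin; along a ray its norm is the
  stated power.\<close>

lemma p_flux_radial_limit:
  fixes u :: "real \<Rightarrow> real"
  assumes sol: "solves_p_laplace p (\<lambda>x::'a::euclidean_space. u (norm x)) F"
  shows "\<exists>L. ((\<lambda>r. \<bar>deriv u r\<bar> powr (p - 1)) \<longlongrightarrow> L) (at_right 0)"
proof -
  let ?U = "\<lambda>x::'a. u (norm x)"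
  have dU: "\<And>x. ?U differentiable (at x)" and df: "\<And>x. p_flux p ?U differentiable (at x)"
    using sol by (auto simp: solves_p_laplace_def)
  obtain e :: 'a where "e \<in> Basis" using SOME_Basis by blast
  then have e: "norm e = 1" by simp
  then have e0: "e \<noteq> 0" by auto
  have "isCont (p_flux p ?U) (0 *\<^sub>R e)" by (rule differentiable_imp_continuous_within[OF df])
  moreover have "isCont (\<lambda>r. r *\<^sub>R e) 0" by simp
  ultimately have "isCont (\<lambda>r. p_flux p ?U (r *\<^sub>R e)) 0" by (rule isCont_o2[rotated])
  from isCont_norm[OF this] have "((\<lambda>r. norm (p_flux p ?U (r *\<^sub>R e))) \<longlongrightarrow> norm (p_flux p ?U (0 *\<^sub>R e))) (at_right 0)"
    unfolding isCont_def by (rule tendsto_within_subset) auto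
  moreover have "\<forall>\<^sub>F r in at_right 0. norm (p_flux p ?U (r *\<^sub>R e)) = \<bar>deriv u r\<bar> powr (p - 1)"
    using eventually_at_right_less[of "0::real"]
  proof eventually_elim
    case (elim r)
    have "norm (p_flux p ?U (r *\<^sub>R e)) = \<bar>deriv u r\<bar> * \<bar>deriv u r\<bar> powr (p - 2)"
      using elim e e0 differentiable_radial(2)[OF dU, of r] by (simp add: p_flux_radial abs_mult norm_sgn)
    also have "\<dots> = \<bar>deriv u r\<bar> powr (p - 1)"
      by (cases "deriv u r = 0") (auto simp: powr_mult_base)
    finally show ?case .
  qed
  ultimately show ?thesis by (blast intro: Lim_transform_eventually)
qed

text \<open>With \<open>F\<close> nonnegative the weighted flux is nondecreasing, and it tends to
  \<open>0\<close> at the origin. Hence it is nonnegative and so is \<open>d\<close>, after which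
  the absolute value can be removed.\<close>

lemma radial_flux:
  fixes d F :: "real \<Rightarrow> real"
  assumes m: "m \<ge> 1" and p: "p > 1"
    and L: "((\<lambda>r. \<bar>d r\<bar> powr (p - 1)) \<longlongrightarrow> L) (at_right 0)"
    and ode: "\<And>r. r > 0 \<Longrightarrow>
      ((\<lambda>r. r ^ m * (d r * \<bar>d r\<bar> powr (p - 2))) has_real_derivative r ^ m * F r) (at r)"
    and F: "\<And>r. r > 0 \<Longrightarrow> F r \<ge> 0"
  shows "r > 0 \<Longrightarrow> d r \<ge> 0"
    and "r > 0 \<Longrightarrow> ((\<lambda>r. r ^ m * d r powr (p - 1)) has_real_derivative r ^ m * F r) (at r)"
    and "((\<lambda>r. r ^ m * d r powr (p - 1)) \<longlongrightarrow> 0) (at_right 0)"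
    and "\<exists>Y. \<forall>\<^sub>F r in at_right 0. d r \<le> Y"
proof -
  define z where "z = (\<lambda>r. r ^ m * (d r * \<bar>d r\<bar> powr (p - 2)))"
  have abs: "\<bar>d r\<bar> * \<bar>d r\<bar> powr (p - 2) = \<bar>d r\<bar> powr (p - 1)" for r
    by (cases "d r = 0") (auto simp: powr_mult_base)
  have "((\<lambda>r. r ^ m * \<bar>d r\<bar> powr (p - 1)) \<longlongrightarrow> 0 ^ m * L) (at_right 0)" by (intro tendsto_intros L)
  \<comment> \<open>\<open>m \<ge> 1\<close>, that is, dimension at least two, makes the weight
    vanish at the origin whatever \<open>L\<close> is.\<close>
  then have "((\<lambda>r. r ^ m * \<bar>d r\<bar> powr (p - 1)) \<longlongrightarrow> 0) (at_right 0)" using m by (simp add: power_0_left)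
  moreover have "\<forall>\<^sub>F r in at_right 0. r ^ m * \<bar>d r\<bar> powr (p - 1) = \<bar>z r\<bar>"
    using eventually_at_right_less[of "0::real"]
    by eventually_elim (simp add: z_def abs_mult abs)
  ultimately have z0: "(z \<longlongrightarrow> 0) (at_right 0)"
    by (blast intro: Lim_transform_eventually tendsto_rabs_zero_cancel)
  have z_mono: "z s \<le> z r" if s: "0 < s" "s \<le> r" for s r
  proof (rule DERIV_nonneg_imp_nondecreasing[OF s(2)])
    fix t assume "s \<le> t"
    with s have t: "t > 0" by simp
    with ode[OF t] F[OF t] show "\<exists>y. (z has_real_derivative y) (at t) \<and> 0 \<le> y"
      unfolding z_def by (intro exI[of _ "t ^ m * F t"]) auto
  qed
  show nonneg: "d r \<ge> 0" if r: "r > 0" for r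
  proof -
    have "\<forall>\<^sub>F s in at_right 0. z s \<le> z r"
      using eventually_at_right_real[OF r] by eventually_elim (use z_mono in auto)
    with z0 have z: "0 \<le> z r" by (intro tendsto_upperbound) auto
    show ?thesis
    proof (rule ccontr)
      assume "\<not> d r \<ge> 0"
      then have "d r * \<bar>d r\<bar> powr (p - 2) < 0" by (simp add: mult_less_0_iff)
      then have "z r < 0" unfolding z_def by (rule mult_pos_neg[OF zero_less_power[OF r]])
      with z show False by simp
    qed
  qed
  have zeq: "z r = r ^ m * d r powr (p - 1)" if "r > 0" for r
    using nonneg[OF that] abs[of r] by (simp add: z_def)
  show "((\<lambda>r. r ^ m * d r powr (p - 1)) has_real_derivative r ^ m * F r) (at r)" if r: "r > 0"
    using ode[OF r, folded z_def]
    by (rule has_field_derivative_transform_within_open[of _ _ _ "{0<..}"]) (use r zeq in auto)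
  show "((\<lambda>r. r ^ m * d r powr (p - 1)) \<longlongrightarrow> 0) (at_right 0)"
    using z0 by (rule Lim_transform_eventually) (auto simp: eventually_at_filter zeq)
  have "\<forall>\<^sub>F r in at_right 0. \<bar>d r\<bar> powr (p - 1) < L + 1" by (rule order_tendstoD[OF L]) simp
  then have "\<forall>\<^sub>F r in at_right 0. d r \<le> (L + 1) powr (1 / (p - 1))"
  proof eventually_elim
    case (elim r)
    then have "(\<bar>d r\<bar> powr (p - 1)) powr (1 / (p - 1)) \<le> (L + 1) powr (1 / (p - 1))"
      using p by (intro powr_mono2) auto
    then show ?case using p by (simp add: powr_powr)
  qed
  then show "\<exists>Y. \<forall>\<^sub>F r in at_right 0. d r \<le> Y" by blast
qed

lemma solves_system_radial_system:
  fixes u v :: "real \<Rightarrow> real"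
  assumes p: "p > 1" and n: "DIM('a::euclidean_space) \<ge> 2" and \<alpha>: "\<alpha> \<ge> 0"
    and f: "\<forall>i\<in>{1,2}. mono_on {0..} (f i) \<and> (\<forall>t>0. f i t > 0)"
    and G: "\<forall>j\<in>{1,2,3}. continuous_on {0..} (G j) \<and> mono_on {0..} (G j) \<and> (\<forall>t>0. G j t > 0)"
    and sol: "solves_system p \<alpha> f G (\<lambda>x::'a. u (norm x)) (\<lambda>x::'a. v (norm x))"
    and pos: "\<And>r. r > 0 \<Longrightarrow> u r > 0 \<and> v r > 0"
  shows "radial_system (DIM('a) - 1) (p - 1) \<alpha> (f 1) (f 2) (G 1) (G 2) (G 3) u v (deriv u) (deriv v)"
proof -
  have m: "DIM('a) - 1 \<ge> 1" using n by simp
  obtain L\<^sub>u where Lu: "((\<lambda>r. \<bar>deriv u r\<bar> powr (p - 1)) \<longlongrightarrow> L\<^sub>u) (at_right 0)"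
    using p_flux_radial_limit[of p u] sol unfolding solves_system_def by blast
  obtain L\<^sub>v where Lv: "((\<lambda>r. \<bar>deriv v r\<bar> powr (p - 1)) \<longlongrightarrow> L\<^sub>v) (at_right 0)"
    using p_flux_radial_limit[of p v] sol unfolding solves_system_def by blast
  \<comment> \<open>Positivity is assumed only for \<open>t > 0\<close>, while
    \<open>deriv u\<close> may vanish; continuity settles the sign at \<open>0\<close>.\<close>
  have G0: "G j t \<ge> 0" if j: "j \<in> {1,2,3}" and t: "t \<ge> 0" for j t
  proof -
    have "(G j \<longlongrightarrow> G j 0) (at 0 within {0..})"
      using G j by (auto simp: continuous_on_def)
    then have "(G j \<longlongrightarrow> G j 0) (at_right 0)" by (rule tendsto_within_subset) auto
    moreover have "\<forall>\<^sub>F t in at_right 0. 0 \<le> G j t"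
      using eventually_at_right_less[of "0::real"]
      by eventually_elim (use G j in \<open>auto intro: less_imp_le\<close>)
    ultimately have "G j 0 \<ge> 0" by (intro tendsto_lowerbound) auto
    then show ?thesis using G j t by (cases "t = 0") (auto intro: less_imp_le)
  qed
  have f0: "f i r > 0" if "i \<in> {1,2}" "r > 0" for i r using f that by blast
  note ode = solves_system_radial[OF sol]
  have Fu: "f 1 r * G 1 (v r) * rpow \<bar>deriv u r\<bar> \<alpha> \<ge> 0" if "r > 0" for r
    using f0[of 1 r] G0[of 1 "v r"] pos[OF that] that by (auto simp: rpow_def)
  have Fv: "f 2 r * G 2 (v r) * G 3 \<bar>deriv u r\<bar> \<ge> 0" if "r > 0" for r
    using f0[of 2 r] G0[of 2 "v r"] G0[of 3 "\<bar>deriv u r\<bar>"] pos[OF that] that by auto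
  have du: "deriv u r \<ge> 0" if "r > 0" for r
    by (rule radial_flux(1)[OF m p Lu ode(5) Fu]) (use that in auto)
  have dv: "deriv v r \<ge> 0" if "r > 0" for r
    by (rule radial_flux(1)[OF m p Lv ode(6) Fv]) (use that in auto)
  have odeu: "((\<lambda>r. r ^ (DIM('a) - 1) * deriv u r powr (p - 1)) has_real_derivative
      r ^ (DIM('a) - 1) * (f 1 r * G 1 (v r) * rpow \<bar>deriv u r\<bar> \<alpha>)) (at r)" if "r > 0" for r
    by (rule radial_flux(2)[OF m p Lu ode(5) Fu]) (use that in auto)
  have odev: "((\<lambda>r. r ^ (DIM('a) - 1) * deriv v r powr (p - 1)) has_real_derivative
      r ^ (DIM('a) - 1) * (f 2 r * G 2 (v r) * G 3 \<bar>deriv u r\<bar>)) (at r)" if "r > 0" for r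
    by (rule radial_flux(2)[OF m p Lv ode(6) Fv]) (use that in auto)
  show ?thesis
  proof
    fix r :: real assume r: "r > 0"
    show "deriv u r \<ge> 0" "deriv v r \<ge> 0" by (fact du[OF r] dv[OF r])+
    show "(u has_real_derivative deriv u r) (at r)" "(v has_real_derivative deriv v r) (at r)"
      using ode(3,4)[OF r] by (auto simp: DERIV_deriv_iff_real_differentiable)
    show "((\<lambda>r. r ^ (DIM('a) - 1) * deriv u r powr (p - 1)) has_real_derivative
        r ^ (DIM('a) - 1) * (f 1 r * G 1 (v r) * rpow (deriv u r) \<alpha>)) (at r)"
      using odeu[OF r] du[OF r] by simp
    show "((\<lambda>r. r ^ (DIM('a) - 1) * deriv v r powr (p - 1)) has_real_derivative
        r ^ (DIM('a) - 1) * (f 2 r * G 2 (v r) * G 3 (deriv u r))) (at r)"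
      using odev[OF r] du[OF r] by simp
    show "u r > 0" "v r > 0" using pos[OF r] by auto
  next
    show "((\<lambda>r. r ^ (DIM('a) - 1) * deriv u r powr (p - 1)) \<longlongrightarrow> 0) (at_right 0)"
      by (rule radial_flux(3)[OF m p Lu ode(5) Fu]) auto
    show "((\<lambda>r. r ^ (DIM('a) - 1) * deriv v r powr (p - 1)) \<longlongrightarrow> 0) (at_right 0)"
      by (rule radial_flux(3)[OF m p Lv ode(6) Fv]) auto
    show "\<exists>Y. \<forall>\<^sub>F r in at_right 0. deriv u r \<le> Y"
      by (rule radial_flux(4)[OF m p Lu ode(5) Fu]) auto
  qed (use m p \<alpha> f G in \<open>auto simp: mono_on_def\<close>)
qed

section \<open>Positive derivatives, power bounds from (B3), and the conclusion\<close>

lemma deriv_pos_of_not_constant: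
  fixes u :: "real \<Rightarrow> real"
  assumes cont: "(u has_real_derivative D) (at 0 within {0..})"
    and u: "\<And>r. r > 0 \<Longrightarrow> (u has_real_derivative y r) (at r)" and y: "\<And>r. r > 0 \<Longrightarrow> y r \<ge> 0"
    and r: "r > 0" and neq: "u r \<noteq> u 0"
  shows "\<exists>s. 0 < s \<and> s < r \<and> y s > 0"
proof -
  have "continuous_on {0..r} u"
    unfolding continuous_on_eq_continuous_within
  proof
    fix x assume x: "x \<in> {0..r}"
    show "continuous (at x within {0..r}) u"
    proof (cases "x = 0")
      case True
      then show ?thesis using DERIV_continuous[OF cont] by (auto intro: continuous_within_subset)
    next
      case False
      then show ?thesis using x u[of x] by (auto intro: continuous_at_imp_continuous_at_within DERIV_isCont)
    qed
  qed
  then obtain l z where z: "0 < z" "z < r" "DERIV u z :> l" "u r - u 0 = (r - 0) * l"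
    using MVT[of 0 r u] r u by (auto simp: real_differentiable_def)
  have "l = y z" using z u[of z] by (auto dest: DERIV_unique)
  with z neq r y[of z] show ?thesis by (intro exI[of _ z]) (auto simp: less_le)
qed

text \<open>A non-increasing quotient lies above its limit at infinity. Taking
  \<open>s = 1 / t\<close> turns this into information near the origin.\<close>

lemma le_powr_of_antimono_ratio:
  fixes g h :: "real \<Rightarrow> real"
  assumes anti: "\<forall>s\<ge>1. antimono_on {0<..} (\<lambda>t. g (s * t) / h t)"
    and lim: "\<forall>s\<ge>1. ((\<lambda>t. g (s * t) / h t) \<longlongrightarrow> s powr k) at_top"
    and h: "\<And>t. t > 0 \<Longrightarrow> h t > 0" and t: "0 < t" "t \<le> 1"
  shows "h t \<le> g 1 * t powr k"
proof -
  define s where "s = 1 / t"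
  have s: "s \<ge> 1" "s * t = 1" using t by (auto simp: s_def)
  have "\<forall>\<^sub>F t' in at_top. g (s * t') / h t' \<le> g (s * t) / h t"
    using eventually_ge_at_top[of t]
  proof eventually_elim
    case (elim t')
    show ?case using monotone_onD[OF anti[rule_format, OF s(1)], of t t'] elim t by simp
  qed
  with lim s have "s powr k \<le> g (s * t) / h t" by (intro tendsto_upperbound) auto
  then have "h t * s powr k \<le> g 1" using h[OF t(1)] s by (simp add: field_simps)
  then show ?thesis using t by (simp add: s_def powr_divide field_simps)
qed

theorem theorem4p1:
  fixes p \<alpha> :: real
    and f g h :: "nat \<Rightarrow> real \<Rightarrow> real"
    and u v u\<^sub>0 v\<^sub>0 :: "real \<Rightarrow> real"
  assumes p: "p > 1" and n: "CARD('n::finite) \<ge> 2" and \<alpha>: "\<alpha> \<ge> 0"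
    and B1_f: "\<forall>i\<in>{1,2}. continuous_on {0..} (f i) \<and> mono_on {0..} (f i) \<and> (\<forall>t>0. f i t > 0)"
    and B1_gh: "\<forall>j\<in>{1,2,3}. \<forall>G\<in>{g j, h j}.
        continuous_on {0..} G \<and> mono_on {0..} G \<and> (\<forall>t>0. G t > 0)"
    and B2_diff: "\<forall>j\<in>{1,2,3}. g j differentiable_on {0..} \<and> h j differentiable_on {0..}"
    and B2_incr: "\<forall>j\<in>{1,2}. strict_mono_on {0<..} (g j) \<and> strict_mono_on {0<..} (h j)"
    and B3: "\<forall>j\<in>{1,2,3}. \<forall>s\<ge>1. antimono_on {0<..} (\<lambda>t. g j (s * t) / h j t)"
    and B4: "\<exists>k :: nat \<Rightarrow> real. \<forall>j\<in>{1,2,3}. k j \<ge> 0 \<and>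
        (\<forall>s\<ge>1. ((\<lambda>t. g j (s * t) / h j t) \<longlongrightarrow> s powr k j) at_top)"
    and sol: "solves_system p \<alpha> f g (\<lambda>x::real^'n. u (norm x)) (\<lambda>x::real^'n. v (norm x))"
    and sol\<^sub>0: "solves_system p \<alpha> f h (\<lambda>x::real^'n. u\<^sub>0 (norm x)) (\<lambda>x::real^'n. v\<^sub>0 (norm x))"
    and nonconst: "\<not> u constant_on {0..}" "\<not> v constant_on {0..}"
        "\<not> u\<^sub>0 constant_on {0..}" "\<not> v\<^sub>0 constant_on {0..}"
    and pos: "\<forall>r>0. u r > 0 \<and> v r > 0 \<and> u\<^sub>0 r > 0 \<and> v\<^sub>0 r > 0"
    and init: "u 0 > 0" "v 0 > 0"
    and init\<^sub>0: "u\<^sub>0 0 = 0" "v\<^sub>0 0 = 0"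
    and lim_u\<^sub>0: "\<exists>L::real. ((\<lambda>r. u\<^sub>0 r / deriv u\<^sub>0 r) \<longlongrightarrow> L) (at_right 0)"
    and lim_v\<^sub>0: "\<exists>L::real. ((\<lambda>r. v\<^sub>0 r / deriv v\<^sub>0 r) \<longlongrightarrow> L) (at_right 0)"
  shows "((\<lambda>r. u r / u\<^sub>0 r) \<longlongrightarrow> 1) at_top \<and>
         ((\<lambda>r. v r / v\<^sub>0 r) \<longlongrightarrow> 1) at_top \<and>
         ((\<lambda>r. deriv u r / deriv u\<^sub>0 r) \<longlongrightarrow> 1) at_top \<and>
         ((\<lambda>r. deriv v r / deriv v\<^sub>0 r) \<longlongrightarrow> 1) at_top"
proof -
  obtain k :: "nat \<Rightarrow> real" where kB4: "\<forall>j\<in>{1,2,3}. k j \<ge> 0 \<and>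
      (\<forall>s\<ge>1. ((\<lambda>t. g j (s * t) / h j t) \<longlongrightarrow> s powr k j) at_top)"
    using B4 ..
  have k: "\<And>j. j \<in> {1,2,3} \<Longrightarrow> k j \<ge> 0"
    and klim: "\<And>j. j \<in> {1,2,3} \<Longrightarrow> \<forall>s\<ge>1. ((\<lambda>t. g j (s * t) / h j t) \<longlongrightarrow> s powr k j) at_top"
    using kB4 by (auto simp del: insert_iff)
  let ?m = "CARD('n) - 1"
  have dim: "DIM(real^'n) = CARD('n)" by simp
  have gh_pos: "g j t > 0" "h j t > 0" if "j \<in> {1,2,3}" "t > 0" for j t using bspec[OF B1_gh that(1)] that(2) by simp_all
  have gh_mono: "mono_on {0..} (g j)" "mono_on {0..} (h j)" if "j \<in> {1,2,3}" for j
    using bspec[OF B1_gh that] by simp_all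
  have rp: "regular_pair (k j) (g j) (h j)" if j: "j \<in> {1,2,3}" for j
    unfolding regular_pair_def using k[OF j] klim[OF j] gh_pos[OF j] gh_mono[OF j]
    by (auto simp: mono_on_def)
  interpret s: radial_system ?m "p - 1" \<alpha> "f 1" "f 2" "g 1" "g 2" "g 3" u v "deriv u" "deriv v"
    by (rule solves_system_radial_system[OF p _ \<alpha> _ _ sol, unfolded dim])
      (use n B1_f B1_gh pos in auto)
  interpret s0: radial_system ?m "p - 1" \<alpha> "f 1" "f 2" "h 1" "h 2" "h 3" u\<^sub>0 v\<^sub>0 "deriv u\<^sub>0" "deriv v\<^sub>0"
    by (rule solves_system_radial_system[OF p _ \<alpha> _ _ sol\<^sub>0, unfolded dim])
      (use n B1_f B1_gh pos in auto)
  \<comment> \<open>As \<open>u\<^sub>0\<close> vanishes at \<open>0\<close> and is positive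
    afterwards, the mean value theorem gives a positive derivative somewhere before each
    \<open>r\<close>, and positivity persists up to \<open>r\<close>.\<close>
  have y0: "deriv u\<^sub>0 r > 0" if r: "r > 0" for r
  proof -
    have "u\<^sub>0 r > 0" using pos r by blast
    then have "u\<^sub>0 r \<noteq> u\<^sub>0 0" using init\<^sub>0(1) by simp
    from deriv_pos_of_not_constant[OF solves_system_radial(1)[OF sol\<^sub>0] s0.deriv_u s0.y_nonneg r this]
    show ?thesis using s0.y_pos_mono by force
  qed
  have \<alpha>p: "\<alpha> < p - 1" by (rule s0.\<alpha>_less[OF y0])
  \<comment> \<open>For \<open>u\<close> the derivative may vanish near the origin; one point with
    positive derivative suffices for the behaviour at infinity.\<close>
  obtain r where "r \<ge> 0" "u r \<noteq> u 0" using nonconst(1) by (auto simp: constant_on_def)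
  then have "r > 0" "u r \<noteq> u 0" by (cases "r = 0"; simp)+
  from deriv_pos_of_not_constant[OF solves_system_radial(1)[OF sol] s.deriv_u s.y_nonneg this]
  obtain a where a: "a > 0" "deriv u a > 0" by blast
  have "(v\<^sub>0 \<longlongrightarrow> v\<^sub>0 0) (at 0 within {0..})"
    using DERIV_continuous[OF solves_system_radial(2)[OF sol\<^sub>0]] by (simp add: continuous_within)
  then have v0: "(v\<^sub>0 \<longlongrightarrow> 0) (at_right 0)" unfolding init\<^sub>0 by (rule tendsto_within_subset) auto
  have h_le: "h j t \<le> g j 1 * t powr k j" if "j \<in> {1,2,3}" "0 < t" "t \<le> 1" for j t
    using that B3 by (intro le_powr_of_antimono_ratio klim gh_pos) auto
  have sub: "k 2 + k 1 * k 3 / (p - 1 - \<alpha>) < p - 1"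
    by (rule s0.subcritical[OF y0 \<alpha>p v0 k k k h_le h_le h_le]) auto
  \<comment> \<open>Both solutions need the same \<open>A\<close>. The two exponents \<tau> agree,
    since they depend only on \<open>p\<close> and \<alpha>.\<close>
  from eventually_conj[OF s.eventually_tail_solution[OF a \<alpha>p]
      s0.eventually_tail_solution[OF zero_less_one y0[OF zero_less_one] \<alpha>p]]
  obtain A where "tail_solution (\<lambda>r. (r ^ ?m) powr s.\<tau>) (\<lambda>r. r ^ ?m)
      (\<lambda>r. s.\<tau> * (r ^ ?m) powr s.\<tau> * f 1 r) (\<lambda>r. r ^ ?m * f 2 r) (p - 1 - \<alpha>) (p - 1)
      (g 1) (g 2) (g 3) u v (deriv u) (deriv v) A"
    "tail_solution (\<lambda>r. (r ^ ?m) powr s.\<tau>) (\<lambda>r. r ^ ?m)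
      (\<lambda>r. s.\<tau> * (r ^ ?m) powr s.\<tau> * f 1 r) (\<lambda>r. r ^ ?m * f 2 r) (p - 1 - \<alpha>) (p - 1)
      (h 1) (h 2) (h 3) u\<^sub>0 v\<^sub>0 (deriv u\<^sub>0) (deriv v\<^sub>0) A"
    unfolding s.\<tau>_def s0.\<tau>_def eventually_at_top_linorder by blast
  then have "tail_comparison (\<lambda>r. (r ^ ?m) powr s.\<tau>) (\<lambda>r. r ^ ?m)
      (\<lambda>r. s.\<tau> * (r ^ ?m) powr s.\<tau> * f 1 r) (\<lambda>r. r ^ ?m * f 2 r) (p - 1 - \<alpha>) (p - 1)
      (g 1) (g 2) (g 3) u v (deriv u) (deriv v) A
      (h 1) (h 2) (h 3) u\<^sub>0 v\<^sub>0 (deriv u\<^sub>0) (deriv v\<^sub>0) (k 1) (k 2) (k 3)"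
    using rp sub by (intro tail_comparison.intro tail_comparison_axioms.intro) auto
  from tail_asymptotics[OF this] show ?thesis by blast
qed

end
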